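(* (Global Convergence.) Let $\{\mathbf{X}^t\}_{t=0}^\infty$ be generated by the algorithm NLOA (described in the context) and let the assumption with constants $\sigma,L$ stated in the context hold. Let $C_1\triangleq\lambda_n(\mathbf{\Sigma})/\sigma+\sigma^{-3/2}$ and $C_2\triangleq 2\sigma(1-\omega)/L$ (constants independent of the current solution $\mathbf{X}^t$), and let $\epsilon$ be a sufficiently small positive constant. (i) There exists a strictly positive constant $\alpha\le\min\bigl(1,\ 1/(\sqrt{L}\,C_1)-\epsilon,\ C_2\bigr)$ such that for all $t$ the step size $\alpha^t=\alpha$ satisfies the positive definiteness condition $\mathbf{X}^t+\alpha^t\mathbf{D}^t\succ\mathbf{0}$ and the sufficient descent condition $f(\mathbf{X}^t+\alpha^t\mathbf{D}^t)\le f(\mathbf{X}^t)+\alpha^t\omega\langle\mathbf{G}^t,\mathbf{D}^t\rangle$. (ii) The sequence $f(\mathbf{X}^t)$ is non-increasing, and any cluster point of the sequence $\mathbf{X}^t$ is the global optimal solution of $\min_{\mathbf{X}\succ\mathbf{0}} f(\mathbf{X})+p(\mathbf{X})$.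
   Context: Let $\mathbf{\Sigma}\in\mathbb{R}^{n\times n}$ be symmetric and $f(\mathbf{X})=\langle\mathbf{\Sigma},\mathbf{X}\rangle-\log\det(\mathbf{X})$ on symmetric positive definite matrices ($\mathbf{X}\succ\mathbf{0}$). Let $S$ be a set of matrix positions (a support set, symmetric under transposition), $Z$ its complement in the set of all $n^2$ positions, $\Omega=\{\mathbf{X}:\mathbf{X}_Z=\mathbf{0}\}$, and $p=I_\Omega$ the indicator function ($0$ on $\Omega$, $+\infty$ elsewhere). The convex problem is $\min_{\mathbf{X}\succ\mathbf{0}}f(\mathbf{X})+p(\mathbf{X})$, i.e. minimize $f$ over $\mathbf{X}\succ\mathbf{0}$ with $\mathbf{X}_Z=\mathbf{0}$. Notation: $g(\mathbf{X})=\mathbf{\Sigma}-\mathbf{X}^{-1}$ and $h(\mathbf{X})=\mathbf{X}^{-1}\otimes\mathbf{X}^{-1}$ are the gradient and Hessian of $f$; $\mathbf{G}^t=g(\mathbf{X}^t)$, $\mathbf{H}^t=h(\mathbf{X}^t)$. $\mathrm{vec}$ stacks columns. $\lambda_1\le\dots\le\lambda_n$ denote eigenvalues in increasing order. The Newton direction is the exact minimizer $$\mathbf{D}^t=d(\mathbf{X}^t)=\arg\min_{\mathbf{\Delta}}\ f(\mathbf{X}^t)+\langle\mathbf{\Delta},\mathbf{G}^t\rangle+\tfrac12\mathrm{vec}(\mathbf{\Delta})^T\mathbf{H}^t\mathrm{vec}(\mathbf{\Delta})+p(\mathbf{X}^t+\mathbf{\Delta}).$$ Algorithm NLOA: start from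 $\mathbf{X}^0\succ\mathbf{0}$ with $\mathbf{X}^0_Z=\mathbf{0}$ and iterate $\mathbf{X}^{t+1}=\mathbf{X}^t+\alpha^t\mathbf{D}^t$, $t=0,1,2,\dots$, where with fixed constants $0<\beta<1$ and $0<\omega<0.5$ the step size $\alpha^t$ is $\beta^m$ for the smallest integer $m\ge0$ such that $\mathbf{X}^t+\alpha^t\mathbf{D}^t\succ\mathbf{0}$ and $f(\mathbf{X}^t+\alpha^t\mathbf{D}^t)\le f(\mathbf{X}^t)+\alpha^t\omega\langle\mathbf{G}^t,\mathbf{D}^t\rangle$. Assumption: $f$ is strongly convex with modulus $\sigma>0$ and has Lipschitz continuous gradient with constant $L$ for all $\mathbf{X}^t$, $t=0,1,2,\dots$; equivalently all eigenvalues of $\mathbf{H}^t$ lie in $[\sigma,L]$, i.e. all eigenvalues of $\mathbf{X}^t$ lie in $[1/\sqrt{L},1/\sqrt{\sigma}]$, for every $t$. *)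

theory Defs
  imports "HOL-Analysis.Analysis"
begin

text \<open>
  On \<open>real^'n^'n\<close> the inner product \<open>A \<bullet> B\<close> of the library is the sum of the products of
  corresponding entries, i.e. the Frobenius (trace) inner product.
\<close>

definition pos_def_mat :: "real^'n^'n \<Rightarrow> bool" where
  "pos_def_mat X \<longleftrightarrow> transpose X = X \<and> (\<forall>v. v \<noteq> 0 \<longrightarrow> 0 < v \<bullet> (X *v v))"

definition eigenvalues :: "real^'m^'m \<Rightarrow> real set" where
  "eigenvalues A = {k. \<exists>v. v \<noteq> 0 \<and> A *v v = k *\<^sub>R v}"

text \<open>Only used for symmetric matrices, whose set of real eigenvalues is finite and nonempty.\<close>

definition max_eigenvalue :: "real^'m^'m \<Rightarrow> real" where
  "max_eigenvalue A = Max (eigenvalues A)"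

text \<open>
  Vectors of length \<open>n\<^sup>2\<close> are indexed by pairs, read lexicographically: the first component
  selects the block and the second the position inside it. With column stacking the block is the
  column, so entry \<open>(j, i)\<close> of the vector is the matrix entry in row \<open>i\<close> and column \<open>j\<close>.
\<close>

definition vec_stack :: "real^'n^'n \<Rightarrow> real^('n \<times> 'n)" where
  "vec_stack X = (\<chi> q. X $ snd q $ fst q)"

definition kronecker :: "real^'n^'n \<Rightarrow> real^'n^'n \<Rightarrow> real^('n \<times> 'n)^('n \<times> 'n)" where
  "kronecker A B = (\<chi> q r. A $ fst q $ fst r * B $ snd q $ snd r)"

definition f_obj :: "real^'n^'n \<Rightarrow> real^'n^'n \<Rightarrow> real" where
  "f_obj \<Sigma> X = \<Sigma> \<bullet> X - ln (det X)"

definition f_grad :: "real^'n^'n \<Rightarrow> real^'n^'n \<Rightarrow> real^'n^'n" where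
  "f_grad \<Sigma> X = \<Sigma> - matrix_inv X"

definition f_hess :: "real^'n^'n \<Rightarrow> real^('n \<times> 'n)^('n \<times> 'n)" where
  "f_hess X = kronecker (matrix_inv X) (matrix_inv X)"

definition feasible_set :: "('n \<times> 'n) set \<Rightarrow> (real^'n^'n) set" where
  "feasible_set S = {X. \<forall>(i, j) \<in> - S. X $ i $ j = 0}"

definition p_ind :: "('n \<times> 'n) set \<Rightarrow> real^'n^'n \<Rightarrow> ereal" where
  "p_ind S X = (if X \<in> feasible_set S then 0 else \<infinity>)"

definition is_global_opt :: "real^'n^'n \<Rightarrow> ('n \<times> 'n) set \<Rightarrow> real^'n^'n \<Rightarrow> bool" where
  "is_global_opt \<Sigma> S X \<longleftrightarrow>
     is_arg_min (\<lambda>Y. ereal (f_obj \<Sigma> Y) + p_ind S Y) pos_def_mat X"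

text \<open>The minimization ranges over all matrices \<open>\<Delta>\<close>; symmetry of the minimizer is not imposed.\<close>

definition is_newton_direction ::
  "real^'n^'n \<Rightarrow> ('n \<times> 'n) set \<Rightarrow> real^'n^'n \<Rightarrow> real^'n^'n \<Rightarrow> bool" where
  "is_newton_direction \<Sigma> S X D \<longleftrightarrow>
     is_arg_min (\<lambda>\<Delta>. ereal (f_obj \<Sigma> X + \<Delta> \<bullet> f_grad \<Sigma> X
                     + 1/2 * (vec_stack \<Delta> \<bullet> (f_hess X *v vec_stack \<Delta>)))
                   + p_ind S (X + \<Delta>)) (\<lambda>_. True) D"

definition step_ok ::
  "real^'n^'n \<Rightarrow> real \<Rightarrow> real^'n^'n \<Rightarrow> real^'n^'n \<Rightarrow> real \<Rightarrow> bool" where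
  "step_ok \<Sigma> \<omega> X D a \<longleftrightarrow>
     pos_def_mat (X + a *\<^sub>R D) \<and>
     f_obj \<Sigma> (X + a *\<^sub>R D) \<le> f_obj \<Sigma> X + a * \<omega> * (f_grad \<Sigma> X \<bullet> D)"

text \<open>
  Termination of the line search is not part of this definition: if no exponent were acceptable,
  the step size would be left unspecified.
\<close>

definition nloa_sequence ::
  "real^'n^'n \<Rightarrow> ('n \<times> 'n) set \<Rightarrow> real \<Rightarrow> real \<Rightarrow>
   (nat \<Rightarrow> real^'n^'n) \<Rightarrow> (nat \<Rightarrow> real^'n^'n) \<Rightarrow> (nat \<Rightarrow> real) \<Rightarrow> bool" where
  "nloa_sequence \<Sigma> S \<beta> \<omega> X D \<alpha> \<longleftrightarrow>
     pos_def_mat (X 0) \<and> X 0 \<in> feasible_set S \<and>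
     (\<forall>t. is_newton_direction \<Sigma> S (X t) (D t) \<and>
          \<alpha> t = \<beta> ^ (LEAST m. step_ok \<Sigma> \<omega> (X t) (D t) (\<beta> ^ m)) \<and>
          X (Suc t) = X t + \<alpha> t *\<^sub>R D t)"

definition C1 :: "real^'n^'n \<Rightarrow> real \<Rightarrow> real" where
  "C1 \<Sigma> \<sigma> = max_eigenvalue \<Sigma> / \<sigma> + \<sigma> powr (- 3 / 2)"

definition C2 :: "real \<Rightarrow> real \<Rightarrow> real \<Rightarrow> real" where
  "C2 \<sigma> L \<omega> = 2 * \<sigma> * (1 - \<omega>) / L"

text \<open>A cluster point of a sequence is the limit of a subsequence.\<close>

definition cluster_point :: "(nat \<Rightarrow> 'a::topological_space) \<Rightarrow> 'a \<Rightarrow> bool" where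
  "cluster_point X x \<longleftrightarrow> (\<exists>r. strict_mono r \<and> (X \<circ> r) \<longlonglongrightarrow> x)"

end

theory Submission
  imports Defs
begin

text \<open>
  Write \<open>W = X\<^sup>-\<^sup>1\<close>, \<open>G = \<Sigma> - W\<close> and \<open>q(D) = \<langle>D, W D W\<rangle>\<close>, the quadratic form of the Hessian
  \<open>W \<otimes> W\<close>. Everything that has to be known about \<open>f\<close> near a positive definite \<open>X\<close> follows from
  simultaneous diagonalization: for symmetric \<open>D\<close> there are numbers \<open>\<mu>\<^sub>i\<close> with
  \<open>det (X + s D) = det X \<cdot> \<Prod>\<^sub>i (1 + s \<mu>\<^sub>i)\<close>, \<open>\<langle>W, D\<rangle> = \<Sum>\<^sub>i \<mu>\<^sub>i\<close> and \<open>q(D) = \<Sum>\<^sub>i \<mu>\<^sub>i\<^sup>2\<close>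
  (\<open>pos_def_line\<close>). The scalar inequality \<open>ln (1 + x) \<le> x\<close> then says that \<open>f\<close> lies strictly above
  its tangents (\<open>f_obj_tangent\<close>), and \<open>ln (1 + x) \<ge> x - 2 x\<^sup>2\<close> for \<open>\<bar>x\<bar> \<le> 1/2\<close> gives the descent
  inequality \<open>f (X + a D) \<le> f X + a \<langle>G, D\<rangle> + 2 a\<^sup>2 q(D)\<close> as long as \<open>a \<surd>q(D) \<le> 1/2\<close>
  (\<open>f_obj_descent\<close>).

  The Newton direction solves \<open>\<langle>E, G\<rangle> = - \<langle>E, W D W\<rangle>\<close> for all \<open>E\<close> supported on \<open>S\<close>. It is symmetric,
  satisfies \<open>\<langle>G, D\<rangle> = - q(D)\<close>, and \<open>\<surd>q(D) \<le> \<parallel>\<Sigma>\<parallel> / \<surd>\<sigma> + \<surd>n\<close> whatever the iterate is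
  (\<open>newton_decrement_bound\<close>). So one threshold makes every smaller step acceptable at every
  iterate. This yields a constant step below any prescribed positive bound, and it keeps the steps
  of the line search away from \<open>0\<close>.

  Hence each iteration lowers \<open>f\<close> by at least a fixed multiple of \<open>q(D)\<close>. The iterates satisfy
  \<open>\<sigma> \<parallel>X\<parallel>\<^sup>2 \<le> q(X) = n\<close>, so they are bounded, \<open>f\<close> is bounded below along them, and \<open>q(D)\<close> and \<open>D\<close>
  tend to \<open>0\<close>. Two consequences finish the proof.

  First, \<open>\<langle>\<Sigma>, X\<rangle> = n - \<langle>W, D\<rangle>\<close> and \<open>\<bar>\<langle>W, D\<rangle>\<bar> \<le> \<surd>n \<surd>q(D)\<close>, so \<open>\<langle>\<Sigma>, X\<rangle> > 0\<close> for some iterate. This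
  forces \<open>\<lambda>\<^sub>n(\<Sigma>) > 0\<close> although \<open>\<Sigma>\<close> may be indefinite, and so \<open>C\<^sub>1 > 0\<close>: for small \<open>\<epsilon>\<close>
  the prescribed upper bound on the constant step is positive (\<open>C1_pos\<close>).

  Second, for a feasible positive definite \<open>Y\<close> the tangent inequality and stationarity give
  \<open>f Y \<ge> f X - \<langle>Y - X, W D W\<rangle> \<ge> f X - L \<parallel>Y - X\<parallel> \<parallel>D\<parallel>\<close>. Along a subsequence converging to \<open>X'\<close> this
  becomes \<open>f Y \<ge> f X'\<close>, since \<open>det X'\<close> is positive and \<open>f\<close> is therefore continuous there
  (\<open>cluster_point_optimal\<close>). Strict convexity makes the minimizer unique.
\<close>

section \<open>Symmetric matrices and their eigenvalues\<close>

text \<open>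
  The first-order condition at a minimizer of a quadratic function of one real variable. It is
  applied below along lines through the minimizer of a Rayleigh quotient and of the Newton model.
\<close>
lemma linear_coeff_zero:
  fixes b c :: real
  assumes "\<And>s. 0 \<le> s * b + s\<^sup>2 * c"
  shows "b = 0"
proof -
  define k where "k = \<bar>c\<bar> + 1"
  have k: "k > 0" "c - k \<le> -1" by (auto simp: k_def)
  \<comment> \<open>For this \<open>s\<close> the linear term outweighs the quadratic one, because \<open>c < k\<close>.\<close>
  have "0 \<le> (- b / k) * b + (- b / k)\<^sup>2 * c" by (rule assms)
  also have "\<dots> = (b / k)\<^sup>2 * (c - k)"
    using k by (simp add: field_simps power2_eq_square)
  also have "\<dots> \<le> (b / k)\<^sup>2 * (- 1)"
    using k by (intro mult_left_mono) auto
  finally have "(b / k)\<^sup>2 = 0" by (smt (verit) zero_le_power2)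
  then show ?thesis using k by simp
qed

lemma inner_mult_symmetric:
  fixes A :: "real^'n^'n"
  assumes "transpose A = A"
  shows "(A *v x) \<bullet> y = x \<bullet> (A *v y)"
  by (metis assms dot_lmul_matrix transpose_matrix_vector)

lemma inner_matrix_mult_left:
  fixes A :: "real^'n^'m" and B :: "real^'n^'k" and P :: "real^'m^'k"
  shows "(P ** A) \<bullet> B = A \<bullet> (transpose P ** B)"
proof -
  have "(P ** A) \<bullet> B = (\<Sum>i\<in>UNIV. \<Sum>j\<in>UNIV. \<Sum>l\<in>UNIV. P$i$l * A$l$j * B$i$j)"
    by (simp add: inner_vec_def matrix_matrix_mult_def sum_distrib_right)
  also have "\<dots> = (\<Sum>i\<in>UNIV. \<Sum>l\<in>UNIV. \<Sum>j\<in>UNIV. P$i$l * A$l$j * B$i$j)"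
    by (rule sum.cong[OF refl], rule sum.swap)
  also have "\<dots> = (\<Sum>l\<in>UNIV. \<Sum>i\<in>UNIV. \<Sum>j\<in>UNIV. P$i$l * A$l$j * B$i$j)"
    by (rule sum.swap)
  also have "\<dots> = (\<Sum>l\<in>UNIV. \<Sum>j\<in>UNIV. \<Sum>i\<in>UNIV. P$i$l * A$l$j * B$i$j)"
    by (rule sum.cong[OF refl], rule sum.swap)
  also have "\<dots> = A \<bullet> (transpose P ** B)"
    by (simp add: inner_vec_def matrix_matrix_mult_def sum_distrib_left transpose_def mult_ac)
  finally show ?thesis .
qed

lemma inner_transpose:
  fixes A B :: "real^'n^'m"
  shows "transpose A \<bullet> transpose B = A \<bullet> B"
proof -
  have "transpose A \<bullet> transpose B = (\<Sum>i\<in>UNIV. \<Sum>j\<in>UNIV. A$j$i * B$j$i)"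
    by (simp add: inner_vec_def transpose_def)
  also have "\<dots> = (\<Sum>j\<in>UNIV. \<Sum>i\<in>UNIV. A$j$i * B$j$i)" by (rule sum.swap)
  finally show ?thesis by (simp add: inner_vec_def)
qed

lemma inner_matrix_mult_right:
  fixes A :: "real^'m^'k" and B :: "real^'n^'k" and P :: "real^'n^'m"
  shows "(A ** P) \<bullet> B = A \<bullet> (B ** transpose P)"
proof -
  have "(A ** P) \<bullet> B = (transpose P ** transpose A) \<bullet> transpose B"
    by (simp only: inner_transpose matrix_transpose_mul[symmetric])
  also have "\<dots> = transpose A \<bullet> transpose (B ** transpose P)"
    by (simp only: inner_matrix_mult_left matrix_transpose_mul)
  finally show ?thesis by (simp only: inner_transpose)
qed

definition diag_mat :: "('n \<Rightarrow> real) \<Rightarrow> real^'n^'n" where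
  "diag_mat \<mu> = (\<chi> i j. if i = j then \<mu> i else 0)"

lemma diag_mat_nth: "diag_mat a $ i $ j = (if i = j then a i else 0)"
  by (simp add: diag_mat_def)

lemma sum_delta_mult: "(\<Sum>j\<in>UNIV. (if i = j then c else 0) * g j) = c * g i"
  for g :: "'n::finite \<Rightarrow> real"
  by (subst sum.remove[of _ i]) (auto intro!: sum.neutral)

lemma diag_mat_mult_left: "(diag_mat a ** B) $ i $ j = a i * B $ i $ j" for B :: "real^'n^'n"
  by (simp add: matrix_matrix_mult_def diag_mat_nth sum_delta_mult)

lemma diag_mat_mult: "diag_mat a ** diag_mat b = diag_mat (\<lambda>i. a i * b i)"
  by (simp add: vec_eq_iff diag_mat_mult_left) (simp add: diag_mat_nth)

lemma transpose_diag_mat [simp]: "transpose (diag_mat a) = diag_mat a"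
  by (simp add: diag_mat_nth transpose_def vec_eq_iff)

lemma mat_1_eq_diag_mat: "mat 1 = diag_mat (\<lambda>_. 1)"
  by (simp add: diag_mat_def mat_def)

lemma diag_mat_affine: "mat 1 + s *\<^sub>R diag_mat a = diag_mat (\<lambda>i. 1 + s * a i)"
  by (simp add: diag_mat_nth mat_def vec_eq_iff)

lemma det_diag_mat: "det (diag_mat a) = (\<Prod>i\<in>UNIV. a i)"
  by (subst det_diagonal) (auto simp: diag_mat_nth)

lemma inner_diag_mat: "diag_mat a \<bullet> B = (\<Sum>i\<in>UNIV. a i * B $ i $ i)" for B :: "real^'n^'n"
  by (simp add: inner_vec_def diag_mat_nth sum_delta_mult)

lemma diag_mat_vec: "(diag_mat a *v v) $ i = a i * v $ i"
  by (simp add: matrix_vector_mult_def diag_mat_nth sum_delta_mult)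

text \<open>
  Minimize \<open>v \<bullet> A v\<close> over the unit sphere of \<open>V\<close>. The residual \<open>A v - m v\<close> at a minimizer with value \<open>m\<close>
  lies in \<open>V\<close> by invariance, so it is an admissible direction of variation, and the first-order
  condition in this direction says that its norm is zero.
\<close>
lemma symmetric_eigenvector_in_subspace:
  fixes A :: "real^'n^'n"
  assumes sym: "transpose A = A" and V: "subspace V" "V \<noteq> {0}"
    and inv: "\<And>v. v \<in> V \<Longrightarrow> A *v v \<in> V"
  obtains v k where "v \<in> V" "norm v = 1" "A *v v = k *\<^sub>R v"
proof -
  let ?K = "V \<inter> sphere 0 1"
  obtain u where u: "u \<in> V" "u \<noteq> 0"
    using V subspace_0 by blast
  have "compact ?K"
    using closed_subspace[OF V(1)] by (simp add: closed_Int_compact)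
  moreover have "?K \<noteq> {}"
    using u subspace_scale[OF V(1), of u "1 / norm u"] by auto
  moreover have "continuous_on ?K (\<lambda>v. v \<bullet> (A *v v))"
    by (intro continuous_intros matrix_vector_mult_linear_continuous_on)
  ultimately obtain v where v: "v \<in> ?K" and min: "\<forall>w\<in>?K. v \<bullet> (A *v v) \<le> w \<bullet> (A *v w)"
    using continuous_attains_inf[of ?K "\<lambda>v. v \<bullet> (A *v v)"] by blast
  define m where "m = v \<bullet> (A *v v)"
  have vv: "v \<bullet> v = 1" using v by (simp add: norm_eq_1)
  have ge: "m * (w \<bullet> w) \<le> w \<bullet> (A *v w)" if w: "w \<in> V" for w
  proof (cases "w = 0")
    case False
    have "m \<le> (w /\<^sub>R norm w) \<bullet> (A *v (w /\<^sub>R norm w))"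
      unfolding m_def using w False V(1) by (intro bspec[OF min]) (auto simp: subspace_scale)
    also have "\<dots> = (w \<bullet> (A *v w)) / (w \<bullet> w)"
      by (simp add: matrix_vector_mult_scaleR dot_square_norm power2_eq_square field_simps)
    finally show ?thesis using False by (simp add: field_simps)
  qed simp
  define w where "w = A *v v - m *\<^sub>R v"
  have wV: "w \<in> V" using v inv V(1) by (simp add: w_def subspace_diff subspace_scale)
  have "0 \<le> s * (2 * (w \<bullet> w)) + s\<^sup>2 * (w \<bullet> (A *v w) - m * (w \<bullet> w))" for s
  proof -
    have "v + s *\<^sub>R w \<in> V" using v wV V(1) by (simp add: subspace_add subspace_scale)
    note le = ge[OF this]
    have swap: "v \<bullet> (A *v w) = w \<bullet> (A *v v)"
      using inner_mult_symmetric[OF sym, of v w] by (simp add: inner_commute)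
    have form: "(v + s *\<^sub>R w) \<bullet> (A *v (v + s *\<^sub>R w))
        = m + 2 * s * (w \<bullet> (A *v v)) + s\<^sup>2 * (w \<bullet> (A *v w))"
      by (simp add: matrix_vector_right_distrib matrix_vector_mult_scaleR inner_add_left
          inner_add_right swap m_def power2_eq_square distrib_left mult.assoc)
    have sq: "(v + s *\<^sub>R w) \<bullet> (v + s *\<^sub>R w) = 1 + 2 * s * (v \<bullet> w) + s\<^sup>2 * (w \<bullet> w)"
      using vv by (simp add: inner_add_left inner_add_right inner_commute power2_eq_square)
    have ww: "w \<bullet> (A *v v) = w \<bullet> w + m * (v \<bullet> w)"
    proof -
      have "A *v v = w + m *\<^sub>R v" by (simp add: w_def)
      then show ?thesis by (simp add: inner_add_right inner_commute)
    qed
    from le show ?thesis unfolding form sq ww by (simp add: algebra_simps)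
  qed
  from linear_coeff_zero[OF this] have "w = 0" by simp
  with v show thesis by (intro that[of v m]) (auto simp: w_def)
qed

text \<open>
  An orthonormal set of eigenvectors of greatest cardinality is a basis: otherwise its orthogonal
  complement, which is invariant because \<open>A\<close> is symmetric, contains a further eigenvector.
\<close>
theorem symmetric_diagonalization:
  fixes A :: "real^'n^'n"
  assumes sym: "transpose A = A"
  obtains Q \<mu> where "orthogonal_matrix Q" "transpose Q ** A ** Q = diag_mat \<mu>"
proof -
  define good where "good B \<longleftrightarrow> pairwise orthogonal B \<and>
    (\<forall>v\<in>B. norm v = 1 \<and> (\<exists>k. A *v v = k *\<^sub>R v))" for B :: "(real^'n) set"
  have ind: "independent B" if "good B" for B
    using that unfolding good_def by (intro pairwise_orthogonal_independent) auto
  have fin: "finite B \<and> card B \<le> CARD('n)" if "good B" for B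
    using independent_bound[OF ind[OF that]] by simp
  have "good {}" by (simp add: good_def)
  moreover have "\<forall>B. good B \<longrightarrow> card B < Suc (CARD('n))"
    using fin by (simp add: less_Suc_eq_le)
  ultimately obtain B where B: "good B" and max: "\<And>B'. good B' \<Longrightarrow> card B' \<le> card B"
    using ex_has_greatest_nat[of good "{}" card "Suc (CARD('n))"] by blast
  have "card B = CARD('n)"
  proof (rule ccontr)
    assume "card B \<noteq> CARD('n)"
    then have "card B < CARD('n)" using fin[OF B] by simp
    moreover have "dim B = card B" using ind[OF B] by (simp add: dim_eq_card_independent)
    ultimately obtain x where x: "x \<noteq> 0" "\<And>y. y \<in> span B \<Longrightarrow> orthogonal x y"
      using orthogonal_to_subspace_exists[of B] by auto
    let ?V = "{y. \<forall>b\<in>B. orthogonal b y}"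
    have "x \<in> ?V" using x(2) by (auto simp: span_base orthogonal_commute)
    then have "?V \<noteq> {0}" using x(1) by blast
    moreover have "A *v v \<in> ?V" if v: "v \<in> ?V" for v
    proof safe
      fix b assume b: "b \<in> B"
      then obtain k where "A *v b = k *\<^sub>R b" using B by (auto simp: good_def)
      then have "b \<bullet> (A *v v) = k * (b \<bullet> v)"
        using inner_mult_symmetric[OF sym, of b v] by simp
      then show "orthogonal b (A *v v)" using v b by (auto simp: orthogonal_def)
    qed
    ultimately obtain v k where v: "v \<in> ?V" "norm v = 1" "A *v v = k *\<^sub>R v"
      using symmetric_eigenvector_in_subspace[OF sym subspace_orthogonal_to_vectors[of B]] by blast
    have "v \<notin> B" using v by (auto simp: orthogonal_def)
    have "good (insert v B)"
      using B v unfolding good_def by (auto simp: pairwise_insert orthogonal_commute)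
    from max[OF this] show False using fin[OF B] \<open>v \<notin> B\<close> by simp
  qed
  then obtain q where q: "bij_betw q (UNIV :: 'n set) B"
    using fin[OF B] finite_same_card_bij[of "UNIV :: 'n set" B] by auto
  have qB: "q i \<in> B" for i using q by (auto simp: bij_betw_def)
  have qne: "i \<noteq> j \<Longrightarrow> q i \<noteq> q j" for i j using q by (auto simp: bij_betw_def inj_on_def)
  have qq: "q i \<bullet> q j = (if i = j then 1 else 0)" for i j
    using B qB[of i] qB[of j] qne[of i j]
    by (auto simp: good_def pairwise_def orthogonal_def norm_eq_1)
  have "\<forall>i. \<exists>k. A *v q i = k *\<^sub>R q i" using B qB by (auto simp: good_def)
  then obtain \<mu> where \<mu>: "\<And>i. A *v q i = \<mu> i *\<^sub>R q i" by metis
  define Q :: "real^'n^'n" where "Q = (\<chi> i j. q j $ i)"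
  have col: "column j Q = q j" for j by (simp add: Q_def column_def vec_eq_iff)
  have "orthogonal_matrix Q"
    unfolding orthogonal_matrix matrix_mult_transpose_dot_column col
    by (simp add: qq mat_def vec_eq_iff)
  moreover have "transpose Q ** A ** Q = diag_mat \<mu>"
  proof -
    have AQ: "(A ** Q) $ l $ j = \<mu> j * q j $ l" for l j
    proof -
      have "(A ** Q) $ l $ j = (A *v q j) $ l"
        by (simp add: matrix_matrix_mult_def matrix_vector_mult_def Q_def)
      then show ?thesis by (simp add: \<mu>)
    qed
    have "(transpose Q ** (A ** Q)) $ i $ j = \<mu> j * (q i \<bullet> q j)" for i j
    proof -
      have "(transpose Q ** (A ** Q)) $ i $ j = (\<Sum>l\<in>UNIV. q i $ l * (A ** Q) $ l $ j)"
        unfolding matrix_matrix_mult_def[of "transpose Q"] by (simp add: transpose_def Q_def)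
      then show ?thesis by (simp add: AQ inner_vec_def sum_distrib_left mult_ac)
    qed
    then show ?thesis by (simp add: matrix_mul_assoc[symmetric] vec_eq_iff diag_mat_def qq)
  qed
  ultimately show thesis by (rule that)
qed

section \<open>Positive definite matrices\<close>

lemma matrix_add_mult_distrib: "(A + B) ** C = A ** C + B ** C"
  for A B :: "real^'n^'m" and C :: "real^'k^'n"
  by (simp add: vec_eq_iff matrix_matrix_mult_def distrib_right sum.distrib)

lemma matrix_inv_eq:
  fixes A B :: "real^'n^'n"
  assumes "A ** B = mat 1"
  shows "matrix_inv A = B"
proof -
  have BA: "B ** A = mat 1" by (rule matrix_left_right_inverse1[OF assms])
  have inv: "A ** matrix_inv A = mat 1 \<and> matrix_inv A ** A = mat 1"
    unfolding matrix_inv_def by (rule someI[of _ B]) (simp add: assms BA)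
  then have "matrix_inv A = (B ** A) ** matrix_inv A" by (simp add: BA)
  also have "\<dots> = B ** (A ** matrix_inv A)" by (simp only: matrix_mul_assoc)
  also have "\<dots> = B" by (simp add: inv)
  finally show ?thesis .
qed

lemma inner_congruence:
  fixes A P :: "real^'n^'n"
  shows "(P *v u) \<bullet> (A *v (P *v w)) = u \<bullet> ((transpose P ** A ** P) *v w)"
proof -
  have "u \<bullet> ((transpose P ** A ** P) *v w) = u \<bullet> (transpose P *v (A *v (P *v w)))"
    by (simp only: matrix_vector_mul_assoc matrix_mul_assoc)
  also have "\<dots> = (u v* transpose P) \<bullet> (A *v (P *v w))"
    by (simp only: dot_lmul_matrix)
  finally show ?thesis by simp
qed

lemma transpose_congruence:
  fixes A P :: "real^'n^'n"
  assumes "transpose A = A"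
  shows "transpose (transpose P ** A ** P) = transpose P ** A ** P"
  by (simp add: matrix_transpose_mul assms matrix_mul_assoc)

lemma diag_quadratic_form: "w \<bullet> (diag_mat a *v w) = (\<Sum>i\<in>UNIV. a i * (w $ i)\<^sup>2)"
  by (simp add: inner_vec_def diag_mat_vec power2_eq_square mult_ac)

lemma eigenvalues_diagonalized:
  fixes A :: "real^'n^'n"
  assumes Q: "orthogonal_matrix Q" and diag: "transpose Q ** A ** Q = diag_mat \<mu>"
  shows "eigenvalues A = range \<mu>"
proof -
  have QQ: "transpose Q ** Q = mat 1" "Q ** transpose Q = mat 1"
    using Q by (auto simp: orthogonal_matrix_def)
  have QA: "transpose Q ** A = diag_mat \<mu> ** transpose Q"
    by (simp add: diag[symmetric] matrix_mul_assoc[symmetric] QQ)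
  have AQ: "A ** Q = Q ** diag_mat \<mu>"
    by (simp add: diag[symmetric] matrix_mul_assoc QQ)
  show ?thesis
  proof (intro equalityI subsetI)
    fix k assume "k \<in> eigenvalues A"
    then obtain v where v: "v \<noteq> 0" "A *v v = k *\<^sub>R v" by (auto simp: eigenvalues_def)
    define w where "w = transpose Q *v v"
    have "v = Q *v w" unfolding w_def by (simp only: matrix_vector_mul_assoc QQ matrix_vector_mul_lid)
    then have "w \<noteq> 0" using v(1) by auto
    then obtain i where i: "w $ i \<noteq> 0" by (auto simp: vec_eq_iff)
    have "diag_mat \<mu> *v w = transpose Q *v (A *v v)"
      unfolding w_def by (simp only: matrix_vector_mul_assoc QA)
    also have "\<dots> = k *\<^sub>R w" unfolding v(2) w_def by (rule matrix_vector_mult_scaleR)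
    finally have "(diag_mat \<mu> *v w) $ i = (k *\<^sub>R w) $ i" by simp
    then have "\<mu> i * w $ i = k * w $ i" by (simp add: diag_mat_vec)
    with i show "k \<in> range \<mu>" by auto
  next
    fix k assume "k \<in> range \<mu>"
    then obtain i where k: "k = \<mu> i" by auto
    define e :: "real^'n" where "e = axis i 1"
    have "transpose Q *v (Q *v e) = e" by (simp only: matrix_vector_mul_assoc QQ matrix_vector_mul_lid)
    moreover have "e \<noteq> 0" by (simp add: e_def)
    ultimately have "Q *v e \<noteq> 0" by auto
    have de: "diag_mat \<mu> *v e = k *\<^sub>R e"
      by (simp add: vec_eq_iff diag_mat_vec e_def axis_def k)
    have "A *v (Q *v e) = Q *v (diag_mat \<mu> *v e)" by (simp only: matrix_vector_mul_assoc AQ)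
    also have "\<dots> = k *\<^sub>R (Q *v e)" by (simp add: de matrix_vector_mult_scaleR)
    finally show "k \<in> eigenvalues A" using \<open>Q *v e \<noteq> 0\<close> by (auto simp: eigenvalues_def)
  qed
qed

lemma eigenvalues_symmetric:
  fixes A :: "real^'n^'n"
  assumes "transpose A = A"
  shows "finite (eigenvalues A)" "eigenvalues A \<noteq> {}"
proof -
  obtain Q \<mu> where "orthogonal_matrix Q" "transpose Q ** A ** Q = diag_mat \<mu>"
    using symmetric_diagonalization[OF assms] .
  then have "eigenvalues A = range \<mu>" by (rule eigenvalues_diagonalized)
  then show "finite (eigenvalues A)" "eigenvalues A \<noteq> {}" by simp_all
qed

text \<open>
  The three bounds are read off in coordinates with respect to an orthonormal eigenbasis. The last
  one is the operator norm bound, hence the requirement that the spectrum be nonnegative.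
\<close>
lemma symmetric_form_bounds:
  fixes A :: "real^'n^'n"
  assumes sym: "transpose A = A" and ev: "eigenvalues A \<subseteq> {a..b}"
  shows "a * (v \<bullet> v) \<le> v \<bullet> (A *v v)" "v \<bullet> (A *v v) \<le> b * (v \<bullet> v)"
    and "0 \<le> a \<Longrightarrow> \<bar>u \<bullet> (A *v v)\<bar> \<le> b * norm u * norm v"
proof -
  obtain Q \<mu> where Q: "orthogonal_matrix Q" and diag: "transpose Q ** A ** Q = diag_mat \<mu>"
    using symmetric_diagonalization[OF sym] .
  have \<mu>: "a \<le> \<mu> i" "\<mu> i \<le> b" for i
    using subsetD[OF ev, of "\<mu> i"] eigenvalues_diagonalized[OF Q diag] by simp_all
  have QQ: "transpose Q ** Q = mat 1" "Q ** transpose Q = mat 1"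
    using Q by (auto simp: orthogonal_matrix_def)
  define c where "c x = transpose Q *v x" for x
  have Qc: "Q *v c x = x" for x
    unfolding c_def by (simp only: matrix_vector_mul_assoc QQ matrix_vector_mul_lid)
  have inner: "x \<bullet> y = c x \<bullet> c y" for x y
    using inner_congruence[of Q "c x" "mat 1" "c y"] by (simp add: Qc QQ)
  have norm_c: "norm (c x) = norm x" for x
    unfolding norm_eq_sqrt_inner inner[of x x] ..
  have form: "x \<bullet> (A *v y) = c x \<bullet> (diag_mat \<mu> *v c y)" for x y
    using inner_congruence[of Q "c x" A "c y"] by (simp add: Qc diag)
  have sq: "v \<bullet> v = (\<Sum>i\<in>UNIV. (c v $ i)\<^sup>2)"
    unfolding inner[of v v] by (simp add: inner_vec_def power2_eq_square)
  show "a * (v \<bullet> v) \<le> v \<bullet> (A *v v)" "v \<bullet> (A *v v) \<le> b * (v \<bullet> v)"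
    unfolding form diag_quadratic_form sq sum_distrib_left
    by (auto intro!: sum_mono mult_right_mono \<mu>)
  assume "0 \<le> a"
  then have \<mu>0: "0 \<le> \<mu> i" "0 \<le> b" for i using \<mu>[of i] by linarith+
  have "norm (diag_mat \<mu> *v c v) \<le> norm (b *\<^sub>R c v)"
    using \<mu> \<mu>0 by (intro norm_le_componentwise_cart)
      (auto simp: diag_mat_vec abs_mult intro!: mult_right_mono)
  also have "\<dots> = b * norm v" using \<mu>0 by (simp add: norm_c)
  finally have "norm (diag_mat \<mu> *v c v) \<le> b * norm v" .
  moreover have "\<bar>u \<bullet> (A *v v)\<bar> \<le> norm u * norm (diag_mat \<mu> *v c v)"
    using Cauchy_Schwarz_ineq2[of "c u" "diag_mat \<mu> *v c v"]
    by (simp add: form norm_c)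
  ultimately show "\<bar>u \<bullet> (A *v v)\<bar> \<le> b * norm u * norm v"
    by (smt (verit) mult.assoc mult.commute mult_left_mono norm_ge_zero)
qed

lemma form_le_max_eigenvalue:
  fixes A :: "real^'n^'n"
  assumes sym: "transpose A = A"
  shows "v \<bullet> (A *v v) \<le> max_eigenvalue A * (v \<bullet> v)"
proof -
  have "eigenvalues A \<subseteq> {Min (eigenvalues A)..max_eigenvalue A}"
    using eigenvalues_symmetric[OF sym] by (auto simp: max_eigenvalue_def)
  then show ?thesis by (rule symmetric_form_bounds(2)[OF sym])
qed

text \<open>
  \<open>C\<close> is an inverse square root of \<open>X\<close>: an orthonormal eigenbasis rescaled by \<open>1 / \<surd>\<mu>\<^sub>i\<close>.
\<close>
lemma pos_def_whitening:
  fixes X :: "real^'n^'n"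
  assumes X: "pos_def_mat X"
  obtains C :: "real^'n^'n" where "transpose C ** X ** C = mat 1"
proof -
  have sym: "transpose X = X" using X by (simp add: pos_def_mat_def)
  obtain Q \<mu> where Q: "orthogonal_matrix Q" and diag: "transpose Q ** X ** Q = diag_mat \<mu>"
    using symmetric_diagonalization[OF sym] .
  have \<mu>: "0 < \<mu> i" for i
  proof -
    have "\<mu> i \<in> eigenvalues X" using eigenvalues_diagonalized[OF Q diag] by simp
    then obtain v where v: "v \<noteq> 0" "X *v v = \<mu> i *\<^sub>R v" by (auto simp: eigenvalues_def)
    have "0 < v \<bullet> (X *v v)" using X v(1) by (simp add: pos_def_mat_def)
    then have "0 < \<mu> i * (v \<bullet> v)" by (simp add: v(2))
    moreover have "0 < v \<bullet> v" using v by simp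
    ultimately show ?thesis by (simp add: zero_less_mult_iff)
  qed
  define r where "r = diag_mat (\<lambda>i. 1 / sqrt (\<mu> i))"
  have "transpose (Q ** r) ** X ** (Q ** r) = r ** (transpose Q ** X ** Q) ** r"
    by (simp add: matrix_transpose_mul matrix_mul_assoc r_def)
  also have "\<dots> = diag_mat (\<lambda>i. 1 / sqrt (\<mu> i) * \<mu> i * (1 / sqrt (\<mu> i)))"
    by (simp only: diag r_def diag_mat_mult)
  also have "(\<lambda>i. 1 / sqrt (\<mu> i) * \<mu> i * (1 / sqrt (\<mu> i))) = (\<lambda>_. 1)"
    using less_imp_le[OF \<mu>] less_imp_neq[OF \<mu>] by (auto simp: field_simps)
  also have "diag_mat (\<lambda>_. 1) = mat 1" by (simp only: mat_1_eq_diag_mat)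
  finally show thesis by (rule that)
qed

text \<open>
  After whitening \<open>X\<close> to the identity, the symmetric matrix \<open>C\<^sup>T D C\<close> can still be diagonalized by a
  rotation, which leaves the identity unchanged.
\<close>
theorem simultaneous_diagonalization:
  fixes X D :: "real^'n^'n"
  assumes X: "pos_def_mat X" and D: "transpose D = D"
  obtains P :: "real^'n^'n" and \<mu> where "transpose P ** X ** P = mat 1" "transpose P ** D ** P = diag_mat \<mu>"
proof -
  obtain C :: "real^'n^'n" where C: "transpose C ** X ** C = mat 1" using pos_def_whitening[OF X] .
  obtain R \<mu> where R: "orthogonal_matrix R"
    and diag: "transpose R ** (transpose C ** D ** C) ** R = diag_mat \<mu>"
    using symmetric_diagonalization[OF transpose_congruence[OF D, of C]] .
  have "transpose (C ** R) ** X ** (C ** R) = transpose R ** (transpose C ** X ** C) ** R"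
    by (simp add: matrix_transpose_mul matrix_mul_assoc)
  also have "\<dots> = mat 1" using R by (simp add: C orthogonal_matrix_def)
  finally have 1: "transpose (C ** R) ** X ** (C ** R) = mat 1" .
  have 2: "transpose (C ** R) ** D ** (C ** R) = diag_mat \<mu>"
    using diag by (simp add: matrix_transpose_mul matrix_mul_assoc)
  from 1 2 show thesis by (rule that)
qed

lemma matrix_inv_whitening:
  fixes X P :: "real^'n^'n"
  assumes "transpose P ** X ** P = mat 1"
  shows "matrix_inv X = P ** transpose P" "X ** (P ** transpose P) = mat 1"
    "P ** (transpose P ** X) = mat 1"
proof -
  show 1: "P ** (transpose P ** X) = mat 1"
    by (rule matrix_left_right_inverse1[OF assms])
  then have "(P ** transpose P) ** X = mat 1" by (simp add: matrix_mul_assoc)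
  then show 2: "X ** (P ** transpose P) = mat 1" by (rule matrix_left_right_inverse1)
  show "matrix_inv X = P ** transpose P" by (rule matrix_inv_eq[OF 2])
qed

text \<open>
  The \<open>\<mu> i\<close> are the eigenvalues of \<open>D\<close> relative to \<open>X\<close>, that is, those of \<open>X\<^sup>-\<^sup>1\<^sup>/\<^sup>2 D X\<^sup>-\<^sup>1\<^sup>/\<^sup>2\<close>. They turn the
  statements about the line \<open>s \<mapsto> X + s D\<close> into statements about the scalars \<open>1 + s \<mu> i\<close>; the two
  inner products are the first and the second derivative at \<open>s = 0\<close> of \<open>ln det (X + s D)\<close>, the second
  one up to sign.
\<close>
theorem pos_def_line:
  fixes X D :: "real^'n^'n"
  assumes X: "pos_def_mat X" and D: "transpose D = D"
  obtains \<mu> :: "'n \<Rightarrow> real" where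
    "\<And>s. det (X + s *\<^sub>R D) = det X * (\<Prod>i\<in>UNIV. 1 + s * \<mu> i)"
    "\<And>s. pos_def_mat (X + s *\<^sub>R D) \<longleftrightarrow> (\<forall>i. 0 < 1 + s * \<mu> i)"
    "matrix_inv X \<bullet> D = (\<Sum>i\<in>UNIV. \<mu> i)"
    "D \<bullet> (matrix_inv X ** D ** matrix_inv X) = (\<Sum>i\<in>UNIV. (\<mu> i)\<^sup>2)"
    "(\<forall>i. \<mu> i = 0) \<longrightarrow> D = 0"
proof -
  obtain P :: "real^'n^'n" and \<mu> where PX: "transpose P ** X ** P = mat 1" and PD: "transpose P ** D ** P = diag_mat \<mu>"
    using simultaneous_diagonalization[OF X D] .
  note W = matrix_inv_whitening[OF PX]
  have line: "transpose P ** (X + s *\<^sub>R D) ** P = diag_mat (\<lambda>i. 1 + s * \<mu> i)" for s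
  proof -
    have "transpose P ** (X + s *\<^sub>R D) ** P
        = transpose P ** X ** P + s *\<^sub>R (transpose P ** D ** P)"
      by (simp add: matrix_add_ldistrib matrix_add_mult_distrib scalar_matrix_assoc matrix_scalar_ac)
    then show ?thesis by (simp add: PX PD diag_mat_affine)
  qed
  have detP: "(det P)\<^sup>2 * det (X + s *\<^sub>R D) = (\<Prod>i\<in>UNIV. 1 + s * \<mu> i)" for s
    using arg_cong[OF line[of s], of det] by (simp add: det_mul det_diag_mat power2_eq_square mult_ac)
  have detPX: "(det P)\<^sup>2 * det X = 1" using detP[of 0] by simp
  have 1: "det (X + s *\<^sub>R D) = det X * (\<Prod>i\<in>UNIV. 1 + s * \<mu> i)" for s
  proof -
    have "det X * (\<Prod>i\<in>UNIV. 1 + s * \<mu> i) = ((det P)\<^sup>2 * det X) * det (X + s *\<^sub>R D)"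
      unfolding detP[symmetric] by (simp add: mult_ac)
    then show ?thesis by (simp add: detPX)
  qed
  have form: "(P *v w) \<bullet> ((X + s *\<^sub>R D) *v (P *v w)) = (\<Sum>i\<in>UNIV. (1 + s * \<mu> i) * (w $ i)\<^sup>2)" for s w
    unfolding inner_congruence line by (rule diag_quadratic_form)
  have 2: "pos_def_mat (X + s *\<^sub>R D) \<longleftrightarrow> (\<forall>i. 0 < 1 + s * \<mu> i)" for s
  proof
    assume pd: "pos_def_mat (X + s *\<^sub>R D)"
    show "\<forall>i. 0 < 1 + s * \<mu> i"
    proof
      fix i
      define e :: "real^'n" where "e = axis i 1"
      have "(transpose P ** X) *v (P *v e) = e"
        by (simp only: matrix_vector_mul_assoc PX matrix_vector_mul_lid)
      moreover have "e \<noteq> 0" by (simp add: e_def)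
      ultimately have "P *v e \<noteq> 0" by auto
      then have "0 < (P *v e) \<bullet> ((X + s *\<^sub>R D) *v (P *v e))" using pd by (simp add: pos_def_mat_def)
      also have "\<dots> = (\<Sum>j\<in>UNIV. (if i = j then 1 + s * \<mu> i else 0) * 1)"
        unfolding form by (intro sum.cong) (auto simp: e_def axis_def)
      also have "\<dots> = 1 + s * \<mu> i" by (subst sum_delta_mult) simp
      finally show "0 < 1 + s * \<mu> i" .
    qed
  next
    assume pos: "\<forall>i. 0 < 1 + s * \<mu> i"
    have "transpose (X + s *\<^sub>R D) = X + s *\<^sub>R D"
      using X D by (simp add: pos_def_mat_def transpose_def vec_eq_iff)
    moreover have "0 < v \<bullet> ((X + s *\<^sub>R D) *v v)" if v: "v \<noteq> 0" for v
    proof -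
      define w where "w = (transpose P ** X) *v v"
      have vw: "v = P *v w" unfolding w_def by (simp only: matrix_vector_mul_assoc W matrix_vector_mul_lid)
      then have "w \<noteq> 0" using v by auto
      then obtain i where i: "w $ i \<noteq> 0" by (auto simp: vec_eq_iff)
      have "0 < (\<Sum>i\<in>UNIV. (1 + s * \<mu> i) * (w $ i)\<^sup>2)"
        using pos i by (intro sum_pos2[of UNIV i]) (auto simp: less_imp_le)
      then show ?thesis unfolding vw form .
    qed
    ultimately show "pos_def_mat (X + s *\<^sub>R D)" by (simp add: pos_def_mat_def)
  qed
  have "matrix_inv X \<bullet> D = mat 1 \<bullet> (transpose P ** D ** P)"
    unfolding W(1) using inner_matrix_mult_left[of P "transpose P" D]
      inner_matrix_mult_right[of "mat 1" "transpose P" "transpose P ** D"]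
    by simp
  then have 3: "matrix_inv X \<bullet> D = (\<Sum>i\<in>UNIV. \<mu> i)"
    unfolding PD mat_1_eq_diag_mat by (simp add: inner_diag_mat diag_mat_nth)
  have "(matrix_inv X ** D ** matrix_inv X) \<bullet> D = (P ** ((transpose P ** D ** P) ** transpose P)) \<bullet> D"
    unfolding W(1) by (simp add: matrix_mul_assoc)
  also have "\<dots> = diag_mat \<mu> \<bullet> (transpose P ** D ** P)"
    using inner_matrix_mult_left[of P "diag_mat \<mu> ** transpose P" D]
      inner_matrix_mult_right[of "diag_mat \<mu>" "transpose P" "transpose P ** D"]
    by (simp add: PD)
  finally have 4: "D \<bullet> (matrix_inv X ** D ** matrix_inv X) = (\<Sum>i\<in>UNIV. (\<mu> i)\<^sup>2)"
    unfolding PD by (simp add: inner_diag_mat diag_mat_nth inner_commute power2_eq_square)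
  have 5: "D = 0" if "\<And>i. \<mu> i = 0"
  proof -
    have "transpose P ** D ** P = 0"
      unfolding PD by (simp add: that vec_eq_iff diag_mat_nth)
    moreover have "(X ** P) ** (transpose P ** D ** P) ** (transpose P ** X) = D"
    proof -
      have "(X ** P) ** (transpose P ** D ** P) ** (transpose P ** X)
          = (X ** (P ** transpose P)) ** D ** (P ** (transpose P ** X))"
        by (simp only: matrix_mul_assoc)
      then show ?thesis by (simp add: W)
    qed
    ultimately show ?thesis by auto
  qed
  show thesis by (rule that[OF 1 2 3 4]) (use 5 in blast)
qed

lemma pos_def_det_pos:
  fixes X :: "real^'n^'n"
  assumes "pos_def_mat X"
  shows "0 < det X"
proof -
  obtain C :: "real^'n^'n" where C: "transpose C ** X ** C = mat 1" using pos_def_whitening[OF assms] .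
  have "(det C)\<^sup>2 * det X = 1"
    using arg_cong[OF C, of det] by (simp add: det_mul power2_eq_square mult_ac)
  then show ?thesis by (metis zero_less_mult_pos zero_less_one zero_le_power2 less_eq_real_def mult_zero_left)
qed

lemma matrix_inv_pos_def:
  fixes X :: "real^'n^'n"
  assumes "pos_def_mat X"
  shows "X ** matrix_inv X = mat 1" "matrix_inv X ** X = mat 1"
    "transpose (matrix_inv X) = matrix_inv X"
proof -
  obtain C :: "real^'n^'n" where C: "transpose C ** X ** C = mat 1"
    using pos_def_whitening[OF assms] .
  note W = matrix_inv_whitening[OF C]
  show "X ** matrix_inv X = mat 1" unfolding W(1) by (rule W(2))
  then show "matrix_inv X ** X = mat 1" by (rule matrix_left_right_inverse1)
  show "transpose (matrix_inv X) = matrix_inv X" unfolding W(1) by (simp add: matrix_transpose_mul)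
qed

lemma transpose_add: "transpose (A + B) = transpose A + transpose B" for A B :: "real^'n^'m"
  by (simp add: transpose_def vec_eq_iff)

lemma transpose_diff: "transpose (A - B) = transpose A - transpose B" for A B :: "real^'n^'m"
  by (simp add: transpose_def vec_eq_iff)

lemma pos_def_sym: "pos_def_mat X \<Longrightarrow> transpose X = X"
  by (simp add: pos_def_mat_def)

text \<open>
  Writing \<open>X = R R\<^sup>T\<close> makes \<open>\<langle>A, X\<rangle>\<close> the sum of the values of the form of \<open>A\<close> at the columns of \<open>R\<close>.
  All of them would be nonpositive if no eigenvalue of \<open>A\<close> were positive.
\<close>
lemma max_eigenvalue_pos:
  fixes A X :: "real^'n^'n"
  assumes A: "transpose A = A" and X: "pos_def_mat X" and pos: "0 < A \<bullet> X"
  shows "0 < max_eigenvalue A"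
proof (rule ccontr)
  assume neg: "\<not> 0 < max_eigenvalue A"
  obtain C :: "real^'n^'n" where C: "transpose C ** X ** C = mat 1"
    using pos_def_whitening[OF X] .
  define R where "R = X ** C"
  have "R ** transpose R = X ** (C ** transpose C) ** X"
    by (simp add: R_def matrix_transpose_mul pos_def_sym[OF X] matrix_mul_assoc)
  then have RR: "R ** transpose R = X" by (simp add: matrix_inv_whitening[OF C])
  have "A \<bullet> X = (R ** (mat 1 ** transpose R)) \<bullet> A" by (simp add: RR inner_commute)
  also have "\<dots> = mat 1 \<bullet> (transpose R ** A ** R)"
    using inner_matrix_mult_left[of R "mat 1 ** transpose R" A]
      inner_matrix_mult_right[of "mat 1" "transpose R" "transpose R ** A"] by simp
  also have "\<dots> = (\<Sum>i\<in>UNIV. (transpose R ** A ** R) $ i $ i)"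
    unfolding mat_1_eq_diag_mat by (simp add: inner_diag_mat)
  also have "\<dots> \<le> 0"
  proof (rule sum_nonpos)
    fix i
    have "(transpose R ** A ** R) $ i $ i = axis i 1 \<bullet> ((transpose R ** A ** R) *v axis i 1)"
      by (simp add: inner_axis' matrix_vector_mult_basis column_def)
    also have "\<dots> = (R *v axis i 1) \<bullet> (A *v (R *v axis i 1))" by (rule inner_congruence[symmetric])
    also have "\<dots> \<le> max_eigenvalue A * ((R *v axis i 1) \<bullet> (R *v axis i 1))"
      by (rule form_le_max_eigenvalue[OF A])
    also have "\<dots> \<le> 0" using neg by (intro mult_nonpos_nonneg) auto
    finally show "(transpose R ** A ** R) $ i $ i \<le> 0" .
  qed
  finally show False using pos by simp
qed

lemma tendsto_det:
  fixes A :: "'a \<Rightarrow> real^'n^'n"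
  assumes "(A \<longlongrightarrow> B) F"
  shows "((\<lambda>x. det (A x)) \<longlongrightarrow> det B) F"
  unfolding det_def by (intro tendsto_intros assms)

text \<open>
  The least eigenvalue is nonnegative because the form is, and nonzero because the kernel is trivial.
  This is how positive definiteness passes to limits with nonzero determinant.
\<close>
lemma pos_def_of_psd:
  fixes X :: "real^'n^'n"
  assumes sym: "transpose X = X" and psd: "\<And>v. 0 \<le> v \<bullet> (X *v v)" and det: "det X \<noteq> 0"
  shows "pos_def_mat X"
proof -
  define k where "k = Min (eigenvalues X)"
  have k: "k \<in> eigenvalues X" and sub: "eigenvalues X \<subseteq> {k..Max (eigenvalues X)}"
    using eigenvalues_symmetric[OF sym] by (auto simp: k_def)
  then obtain v where v: "v \<noteq> 0" "X *v v = k *\<^sub>R v" by (auto simp: eigenvalues_def)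
  have "0 \<le> k * (v \<bullet> v)" using psd[of v] by (simp add: v)
  moreover have "0 < v \<bullet> v" using v(1) by simp
  ultimately have "0 \<le> k" by (simp add: zero_le_mult_iff)
  moreover have "k \<noteq> 0"
  proof
    assume "k = 0"
    then have "X *v v = X *v 0" using v(2) by simp
    moreover have "inj ((*v) X)" using det by (simp add: inj_matrix_vector_mult invertible_det_nz)
    ultimately show False using v(1) by (blast dest: injD)
  qed
  ultimately have "0 < k" by simp
  then have "0 < w \<bullet> (X *v w)" if "w \<noteq> 0" for w
    using symmetric_form_bounds(1)[OF sym sub, of w] that
    by (smt (verit) inner_gt_zero_iff mult_pos_pos)
  with sym show ?thesis by (simp add: pos_def_mat_def)
qed

section \<open>The objective and its local models\<close>

text \<open>
  Strict concavity of \<open>ln det\<close> reduces to the scalar inequality \<open>ln (1 + \<mu>) \<le> \<mu>\<close>, which is an equality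
  only at \<open>\<mu> = 0\<close>.
\<close>
lemma log_det_tangent:
  fixes X Y :: "real^'n^'n"
  assumes X: "pos_def_mat X" and Y: "pos_def_mat Y"
  shows "ln (det Y) \<le> ln (det X) + matrix_inv X \<bullet> (Y - X)"
    and "X \<noteq> Y \<Longrightarrow> ln (det Y) < ln (det X) + matrix_inv X \<bullet> (Y - X)"
proof -
  have D: "transpose (Y - X) = Y - X"
    using X Y by (simp add: transpose_diff pos_def_sym)
  obtain \<mu> :: "'n \<Rightarrow> real" where det: "\<And>s. det (X + s *\<^sub>R (Y - X)) = det X * (\<Prod>i\<in>UNIV. 1 + s * \<mu> i)"
    and pd: "\<And>s. pos_def_mat (X + s *\<^sub>R (Y - X)) \<longleftrightarrow> (\<forall>i. 0 < 1 + s * \<mu> i)"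
    and tr: "matrix_inv X \<bullet> (Y - X) = (\<Sum>i\<in>UNIV. \<mu> i)"
    and zero: "(\<forall>i. \<mu> i = 0) \<longrightarrow> Y - X = 0"
    using pos_def_line[OF X D] by metis
  have pos: "0 < 1 + \<mu> i" for i using pd[of 1] Y by simp
  have "ln (det Y) = ln (det X) + ln (\<Prod>i\<in>UNIV. 1 + \<mu> i)"
    using det[of 1] ln_mult_pos[OF pos_def_det_pos[OF X] prod_pos[of UNIV "\<lambda>i. 1 + \<mu> i"]] pos by simp
  also have "ln (\<Prod>i\<in>UNIV. 1 + \<mu> i) = (\<Sum>i\<in>UNIV. ln (1 + \<mu> i))"
    using less_imp_neq[OF pos, symmetric] by (intro ln_prod) auto
  finally have eq: "ln (det Y) = ln (det X) + (\<Sum>i\<in>UNIV. ln (1 + \<mu> i))" .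
  have le: "ln (1 + \<mu> i) \<le> \<mu> i" for i using ln_le_minus_one[OF pos[of i]] by simp
  show "ln (det Y) \<le> ln (det X) + matrix_inv X \<bullet> (Y - X)"
    unfolding eq tr using le by (simp add: sum_mono)
  assume "X \<noteq> Y"
  then obtain i where "\<mu> i \<noteq> 0" using zero by auto
  then have "ln (1 + \<mu> i) < \<mu> i"
    using le[of i] ln_eq_minus_one[OF pos[of i]] by fastforce
  then have "(\<Sum>i\<in>UNIV. ln (1 + \<mu> i)) < (\<Sum>i\<in>UNIV. \<mu> i)"
    using le by (intro sum_strict_mono_ex1) auto
  then show "ln (det Y) < ln (det X) + matrix_inv X \<bullet> (Y - X)"
    unfolding eq tr by simp
qed

lemma f_obj_tangent:
  fixes X Y :: "real^'n^'n"
  assumes "pos_def_mat X" "pos_def_mat Y"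
  shows "f_obj \<Sigma> X + f_grad \<Sigma> X \<bullet> (Y - X) \<le> f_obj \<Sigma> Y"
    and "X \<noteq> Y \<Longrightarrow> f_obj \<Sigma> X + f_grad \<Sigma> X \<bullet> (Y - X) < f_obj \<Sigma> Y"
  using log_det_tangent[OF assms]
  by (auto simp: f_obj_def f_grad_def inner_diff_left inner_diff_right)

text \<open>
  The bilinear form of the Hessian \<open>W \<otimes> W\<close>, written on matrices instead of their vectorizations.
\<close>
definition hess_form :: "real^'n^'n \<Rightarrow> real^'n^'n \<Rightarrow> real^'n^'n \<Rightarrow> real" where
  "hess_form X A B = A \<bullet> (matrix_inv X ** B ** matrix_inv X)"

text \<open>
  The hypothesis confines all \<open>a \<mu> i\<close> to \<open>[-1/2, 1/2]\<close>, where \<open>ln (1 + x) \<ge> x - 2 x\<^sup>2\<close>. The admissible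
  steps are thus governed by the size of \<open>D\<close> in the metric of the Hessian at \<open>X\<close>.
\<close>
lemma f_obj_descent:
  fixes X D :: "real^'n^'n"
  assumes X: "pos_def_mat X" and D: "transpose D = D"
    and a: "0 \<le> a" "a * sqrt (hess_form X D D) \<le> 1/2"
  shows "pos_def_mat (X + a *\<^sub>R D)"
    and "f_obj \<Sigma> (X + a *\<^sub>R D) \<le> f_obj \<Sigma> X + a * (f_grad \<Sigma> X \<bullet> D) + 2 * a\<^sup>2 * hess_form X D D"
proof -
  obtain \<mu> :: "'n \<Rightarrow> real" where det: "\<And>s. det (X + s *\<^sub>R D) = det X * (\<Prod>i\<in>UNIV. 1 + s * \<mu> i)"
    and pd: "\<And>s. pos_def_mat (X + s *\<^sub>R D) \<longleftrightarrow> (\<forall>i. 0 < 1 + s * \<mu> i)"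
    and tr: "matrix_inv X \<bullet> D = (\<Sum>i\<in>UNIV. \<mu> i)"
    and q: "D \<bullet> (matrix_inv X ** D ** matrix_inv X) = (\<Sum>i\<in>UNIV. (\<mu> i)\<^sup>2)"
    using pos_def_line[OF X D] by metis
  have small: "\<bar>a * \<mu> i\<bar> \<le> 1/2" for i
  proof -
    have "\<bar>\<mu> i\<bar> \<le> sqrt (hess_form X D D)"
      unfolding hess_form_def q by (intro real_le_rsqrt) (auto intro!: member_le_sum)
    then have "a * \<bar>\<mu> i\<bar> \<le> a * sqrt (hess_form X D D)" using a(1) by (rule mult_left_mono)
    then show ?thesis using a by (simp add: abs_mult)
  qed
  have pos: "0 < 1 + a * \<mu> i" for i using small[of i] by linarith
  then show "pos_def_mat (X + a *\<^sub>R D)" by (simp add: pd)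
  have "ln (det (X + a *\<^sub>R D)) = ln (det X) + ln (\<Prod>i\<in>UNIV. 1 + a * \<mu> i)"
    using det[of a] ln_mult_pos[OF pos_def_det_pos[OF X] prod_pos[of UNIV "\<lambda>i. 1 + a * \<mu> i"]] pos by simp
  also have "ln (\<Prod>i\<in>UNIV. 1 + a * \<mu> i) = (\<Sum>i\<in>UNIV. ln (1 + a * \<mu> i))"
    using less_imp_neq[OF pos, symmetric] by (intro ln_prod) auto
  finally have eq: "ln (det (X + a *\<^sub>R D)) = ln (det X) + (\<Sum>i\<in>UNIV. ln (1 + a * \<mu> i))" .
  have "a * (matrix_inv X \<bullet> D) - 2 * a\<^sup>2 * hess_form X D D = (\<Sum>i\<in>UNIV. a * \<mu> i - 2 * (a * \<mu> i)\<^sup>2)"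
    unfolding hess_form_def q tr by (simp add: sum_subtractf sum_distrib_left power_mult_distrib mult.assoc)
  also have "\<dots> \<le> (\<Sum>i\<in>UNIV. ln (1 + a * \<mu> i))"
  proof (rule sum_mono)
    fix i show "a * \<mu> i - 2 * (a * \<mu> i)\<^sup>2 \<le> ln (1 + a * \<mu> i)"
      using abs_ln_one_plus_x_minus_x_bound[OF small[of i]] by linarith
  qed
  finally have "ln (det X) + (a * (matrix_inv X \<bullet> D) - 2 * a\<^sup>2 * hess_form X D D) \<le> ln (det (X + a *\<^sub>R D))"
    unfolding eq by simp
  then show "f_obj \<Sigma> (X + a *\<^sub>R D) \<le> f_obj \<Sigma> X + a * (f_grad \<Sigma> X \<bullet> D) + 2 * a\<^sup>2 * hess_form X D D"
    by (simp add: f_obj_def f_grad_def inner_diff_left inner_add_right algebra_simps)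
qed

text \<open>
  Cauchy--Schwarz for \<open>\<Sum>\<^sub>i \<mu> i\<close> against \<open>\<Sum>\<^sub>i (\<mu> i)\<^sup>2\<close>, with \<open>\<mu>\<close> as in \<open>pos_def_line\<close>.
\<close>
lemma inner_matrix_inv_le:
  fixes X D :: "real^'n^'n"
  assumes X: "pos_def_mat X" and D: "transpose D = D"
  shows "\<bar>matrix_inv X \<bullet> D\<bar> \<le> sqrt CARD('n) * sqrt (hess_form X D D)" and "0 \<le> hess_form X D D"
proof -
  obtain \<mu> :: "'n \<Rightarrow> real" where tr: "matrix_inv X \<bullet> D = (\<Sum>i\<in>UNIV. \<mu> i)"
    and q: "D \<bullet> (matrix_inv X ** D ** matrix_inv X) = (\<Sum>i\<in>UNIV. (\<mu> i)\<^sup>2)"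
    using pos_def_line[OF X D] by metis
  have "(\<Sum>i\<in>UNIV. \<mu> i)\<^sup>2 \<le> CARD('n) * (\<Sum>i\<in>UNIV. (\<mu> i)\<^sup>2)"
    using Cauchy_Schwarz_ineq_sum[of "\<lambda>_. 1" \<mu> "UNIV :: 'n set"] by simp
  then show "\<bar>matrix_inv X \<bullet> D\<bar> \<le> sqrt CARD('n) * sqrt (hess_form X D D)"
    unfolding hess_form_def q tr real_sqrt_mult[symmetric] by (intro real_le_rsqrt) simp
  show "0 \<le> hess_form X D D" unfolding hess_form_def q by (simp add: sum_nonneg)
qed

lemma hess_form_self:
  fixes X :: "real^'n^'n"
  assumes X: "pos_def_mat X"
  shows "hess_form X X B = matrix_inv X \<bullet> B"
proof -
  note W = matrix_inv_pos_def[OF X]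
  have "hess_form X X B = (matrix_inv X ** X ** matrix_inv X) \<bullet> B"
    unfolding hess_form_def
    using inner_matrix_mult_right[of "matrix_inv X ** X" "matrix_inv X" B]
      inner_matrix_mult_left[of "matrix_inv X" X "B ** matrix_inv X"]
    by (simp add: W matrix_mul_assoc)
  then show ?thesis by (simp add: W)
qed

lemma matrix_inv_inner_self:
  fixes X :: "real^'n^'n"
  assumes X: "pos_def_mat X"
  shows "matrix_inv X \<bullet> X = CARD('n)"
proof -
  have "matrix_inv X \<bullet> (X ** mat 1) = (matrix_inv X ** X) \<bullet> mat 1"
    using inner_matrix_mult_right[of "matrix_inv X" X "mat 1"] by (simp add: pos_def_sym[OF X])
  also have "\<dots> = CARD('n)"
    unfolding matrix_inv_pos_def(2)[OF X] mat_1_eq_diag_mat by (simp add: inner_diag_mat diag_mat_nth)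
  finally show ?thesis by simp
qed

lemma hess_form_commute:
  assumes X: "pos_def_mat X"
  shows "hess_form X A B = hess_form X B A"
proof -
  note W = matrix_inv_pos_def[OF X]
  have "hess_form X A B = (matrix_inv X ** B ** matrix_inv X) \<bullet> A"
    by (simp add: hess_form_def inner_commute)
  also have "\<dots> = B \<bullet> (matrix_inv X ** A ** matrix_inv X)"
    using inner_matrix_mult_right[of "matrix_inv X ** B" "matrix_inv X" A]
      inner_matrix_mult_left[of "matrix_inv X" B "A ** matrix_inv X"]
    by (simp add: W matrix_mul_assoc)
  finally show ?thesis by (simp add: hess_form_def)
qed

lemma hess_form_transpose:
  assumes X: "pos_def_mat X"
  shows "hess_form X (transpose A) (transpose B) = hess_form X A B"
proof -
  have "matrix_inv X ** transpose B ** matrix_inv X = transpose (matrix_inv X ** B ** matrix_inv X)"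
    by (simp add: matrix_transpose_mul matrix_inv_pos_def[OF X] matrix_mul_assoc)
  then show ?thesis by (simp add: hess_form_def inner_transpose)
qed

lemma hess_form_linear:
  "hess_form X (A + A') B = hess_form X A B + hess_form X A' B"
  "hess_form X (A - A') B = hess_form X A B - hess_form X A' B"
  "hess_form X (s *\<^sub>R A) B = s * hess_form X A B"
  by (simp_all add: hess_form_def inner_add_left inner_diff_left)

lemma sum_pairs: "(\<Sum>r\<in>UNIV. g (fst r) (snd r)) = (\<Sum>a\<in>UNIV. \<Sum>b\<in>UNIV. g a b)"
  for g :: "'a::finite \<Rightarrow> 'b::finite \<Rightarrow> real"
  by (simp add: sum.cartesian_product case_prod_beta UNIV_Times_UNIV)

lemma inner_vec_stack: "vec_stack A \<bullet> vec_stack B = A \<bullet> B"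
proof -
  have "vec_stack A \<bullet> vec_stack B = (\<Sum>j\<in>UNIV. \<Sum>i\<in>UNIV. A $ i $ j * B $ i $ j)"
    unfolding sum_pairs[symmetric] by (simp add: inner_vec_def vec_stack_def)
  also have "\<dots> = (\<Sum>i\<in>UNIV. \<Sum>j\<in>UNIV. A $ i $ j * B $ i $ j)" by (rule sum.swap)
  finally show ?thesis by (simp add: inner_vec_def)
qed

text \<open>
  With column stacking, the block index of the Kronecker product acts on the columns of \<open>\<Delta>\<close> and the
  inner index on its rows, so \<open>A\<close> ends up on the right.
\<close>
lemma kronecker_vec_stack: "kronecker A B *v vec_stack \<Delta> = vec_stack (B ** \<Delta> ** transpose A)"
proof -
  have "(kronecker A B *v vec_stack \<Delta>) $ q = vec_stack (B ** \<Delta> ** transpose A) $ q" for q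
  proof -
    have "(kronecker A B *v vec_stack \<Delta>) $ q
        = (\<Sum>a\<in>UNIV. \<Sum>b\<in>UNIV. A $ fst q $ a * B $ snd q $ b * \<Delta> $ b $ a)"
      unfolding sum_pairs[symmetric] by (simp add: matrix_vector_mult_def kronecker_def vec_stack_def)
    also have "\<dots> = vec_stack (B ** \<Delta> ** transpose A) $ q"
      by (simp add: vec_stack_def matrix_matrix_mult_def transpose_def sum_distrib_right sum_distrib_left mult_ac)
    finally show ?thesis .
  qed
  then show ?thesis by (simp add: vec_eq_iff)
qed

lemma hess_form_f_hess:
  assumes "pos_def_mat X"
  shows "vec_stack A \<bullet> (f_hess X *v vec_stack B) = hess_form X A B"
  by (simp only: f_hess_def kronecker_vec_stack inner_vec_stack hess_form_def matrix_inv_pos_def[OF assms])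

lemma transpose_f_hess:
  assumes "pos_def_mat X"
  shows "transpose (f_hess X) = f_hess X"
proof -
  have "matrix_inv X $ i $ j = matrix_inv X $ j $ i" for i j
    using arg_cong[OF matrix_inv_pos_def(3)[OF assms], of "\<lambda>M. M $ i $ j"] by (simp add: transpose_def)
  then show ?thesis by (simp add: f_hess_def kronecker_def transpose_def vec_eq_iff)
qed

lemma hess_form_bounds:
  assumes X: "pos_def_mat X" and ev: "eigenvalues (f_hess X) \<subseteq> {\<sigma>..L}" and \<sigma>: "0 \<le> \<sigma>"
  shows "\<sigma> * (norm A)\<^sup>2 \<le> hess_form X A A"
    and "\<bar>hess_form X A B\<bar> \<le> L * norm A * norm B"
  using symmetric_form_bounds(1)[OF transpose_f_hess[OF X] ev, of "vec_stack A"]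
    symmetric_form_bounds(3)[OF transpose_f_hess[OF X] ev \<sigma>, of "vec_stack A" "vec_stack B"]
  by (simp_all add: hess_form_f_hess[OF X] inner_vec_stack norm_eq_sqrt_inner)

section \<open>The Newton direction and admissible steps\<close>

lemma in_feasible_set_iff: "A \<in> feasible_set S \<longleftrightarrow> (\<forall>i j. (i, j) \<notin> S \<longrightarrow> A $ i $ j = 0)"
  by (auto simp: feasible_set_def)

lemma feasible_add: "A \<in> feasible_set S \<Longrightarrow> B \<in> feasible_set S \<Longrightarrow> A + B \<in> feasible_set S"
  by (simp add: in_feasible_set_iff)

lemma feasible_diff: "A \<in> feasible_set S \<Longrightarrow> B \<in> feasible_set S \<Longrightarrow> A - B \<in> feasible_set S"
  by (simp add: in_feasible_set_iff)

lemma feasible_scale: "A \<in> feasible_set S \<Longrightarrow> s *\<^sub>R A \<in> feasible_set S"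
  by (simp add: in_feasible_set_iff)

lemma feasible_transpose: "sym S \<Longrightarrow> A \<in> feasible_set S \<Longrightarrow> transpose A \<in> feasible_set S"
  by (auto simp: in_feasible_set_iff transpose_def dest: symD)

text \<open>
  The zero direction has a finite value, so the minimizer \<open>D\<close> respects the support. Varying it
  along a supported \<open>E\<close> then gives a quadratic function of one variable that is minimal at \<open>0\<close>.
\<close>
lemma newton_direction_stationary:
  assumes X: "pos_def_mat X" "X \<in> feasible_set S" and newton: "is_newton_direction \<Sigma> S X D"
  shows "D \<in> feasible_set S"
    and "E \<in> feasible_set S \<Longrightarrow> E \<bullet> f_grad \<Sigma> X = - hess_form X E D"
proof -
  define \<phi> where "\<phi> \<Delta> = f_obj \<Sigma> X + \<Delta> \<bullet> f_grad \<Sigma> X + 1/2 * hess_form X \<Delta> \<Delta>" for \<Delta>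
  have min: "\<not> ereal (\<phi> \<Delta>) + p_ind S (X + \<Delta>) < ereal (\<phi> D) + p_ind S (X + D)" for \<Delta>
    using newton unfolding is_newton_direction_def is_arg_min_def hess_form_f_hess[OF X(1)] \<phi>_def by simp
  show DF: "D \<in> feasible_set S"
  proof (rule ccontr)
    assume "D \<notin> feasible_set S"
    then have "X + D \<notin> feasible_set S" using feasible_diff[of "X + D" S X] X(2) by auto
    then show False using min[of 0] X(2) by (simp add: p_ind_def)
  qed
  assume E: "E \<in> feasible_set S"
  have "0 \<le> s * (E \<bullet> f_grad \<Sigma> X + hess_form X E D) + s\<^sup>2 * (hess_form X E E / 2)" for s
  proof -
    have "X + (D + s *\<^sub>R E) \<in> feasible_set S" "X + D \<in> feasible_set S"
      using X(2) DF E by (auto intro!: feasible_add feasible_scale)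
    then have "\<phi> D \<le> \<phi> (D + s *\<^sub>R E)" using min[of "D + s *\<^sub>R E"] by (simp add: p_ind_def)
    moreover have "hess_form X (D + s *\<^sub>R E) (D + s *\<^sub>R E)
        = hess_form X D D + 2 * s * hess_form X E D + s\<^sup>2 * hess_form X E E"
    proof -
      have "hess_form X B (D + s *\<^sub>R E) = hess_form X D B + s * hess_form X E B" for B
        by (simp add: hess_form_commute[OF X(1), of B] hess_form_linear)
      then show ?thesis
        by (simp add: hess_form_linear hess_form_commute[OF X(1), of D E] power2_eq_square algebra_simps)
    qed
    ultimately show ?thesis by (simp add: \<phi>_def inner_add_left algebra_simps)
  qed
  from linear_coeff_zero[OF this] show "E \<bullet> f_grad \<Sigma> X = - hess_form X E D" by simp
qed

text \<open>
  The antisymmetric part \<open>E\<close> of \<open>D\<close> is supported on \<open>S\<close> since \<open>S\<close> is symmetric. It is orthogonal to the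
  symmetric gradient, so stationarity makes it orthogonal to \<open>D\<close>, and by transposition to \<open>D\<^sup>T\<close>, in
  the Hessian metric. Hence it is orthogonal to itself and vanishes, the metric being definite.
\<close>
lemma newton_direction_symmetric:
  assumes X: "pos_def_mat X" "X \<in> feasible_set S" and newton: "is_newton_direction \<Sigma> S X D"
    and \<Sigma>: "transpose \<Sigma> = \<Sigma>" and S: "sym S"
    and ev: "eigenvalues (f_hess X) \<subseteq> {\<sigma>..L}" and \<sigma>: "0 < \<sigma>"
  shows "transpose D = D"
proof -
  note stat = newton_direction_stationary[OF X newton]
  define E where "E = D - transpose D"
  have E: "E \<in> feasible_set S" unfolding E_def by (intro feasible_diff feasible_transpose S stat)
  have ET: "transpose E = - E" by (simp add: E_def transpose_diff)
  have G: "transpose (f_grad \<Sigma> X) = f_grad \<Sigma> X"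
    by (simp add: f_grad_def transpose_diff \<Sigma> matrix_inv_pos_def[OF X(1)])
  have "E \<bullet> f_grad \<Sigma> X = 0"
    using inner_transpose[of E "f_grad \<Sigma> X"] by (simp add: G ET)
  then have 1: "hess_form X E D = 0" using stat(2)[OF E] by simp
  have "hess_form X (transpose E) (transpose D) = hess_form X E D" by (rule hess_form_transpose[OF X(1)])
  then have 2: "hess_form X E (transpose D) = 0"
    using 1 by (simp add: ET hess_form_def)
  have "hess_form X E E = hess_form X D E - hess_form X (transpose D) E"
    by (subst (1) E_def) (rule hess_form_linear)
  also have "\<dots> = 0" using 1 2 by (simp add: hess_form_commute[OF X(1), of _ E])
  finally have "\<sigma> * (norm E)\<^sup>2 \<le> 0" using hess_form_bounds(1)[OF X(1) ev, of E] \<sigma> by simp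
  then have "E = 0" using \<sigma> by (simp add: mult_le_0_iff)
  then show ?thesis by (simp add: E_def)
qed

text \<open>
  With \<open>r = \<surd>q(D)\<close> the identity \<open>q(D) = \<langle>W, D\<rangle> - \<langle>\<Sigma>, D\<rangle>\<close> bounds \<open>r\<^sup>2\<close> by a multiple of \<open>r\<close>: the first term is
  at most \<open>\<surd>n r\<close>, and \<open>\<parallel>D\<parallel> \<le> r / \<surd>\<sigma>\<close>. The resulting bound does not depend on \<open>X\<close>.
\<close>
lemma newton_decrement_bound:
  fixes X D \<Sigma> :: "real^'n^'n"
  assumes X: "pos_def_mat X" and D: "transpose D = D"
    and dec: "f_grad \<Sigma> X \<bullet> D = - hess_form X D D"
    and \<sigma>: "0 < \<sigma>" "\<sigma> * (norm D)\<^sup>2 \<le> hess_form X D D"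
  shows "sqrt (hess_form X D D) \<le> norm \<Sigma> / sqrt \<sigma> + sqrt CARD('n)"
proof -
  define r where "r = sqrt (hess_form X D D)"
  have q0: "0 \<le> hess_form X D D" by (rule inner_matrix_inv_le[OF X D])
  then have r: "0 \<le> r" "hess_form X D D = r\<^sup>2" by (auto simp: r_def)
  have "norm D = sqrt ((norm D)\<^sup>2)" by simp
  also have "\<dots> \<le> sqrt (hess_form X D D / \<sigma>)"
    using \<sigma> by (intro real_sqrt_le_mono) (simp add: field_simps)
  finally have nD: "norm D \<le> r / sqrt \<sigma>" by (simp add: r_def real_sqrt_divide)
  have "r\<^sup>2 = matrix_inv X \<bullet> D - \<Sigma> \<bullet> D" using dec r(2) by (simp add: f_grad_def inner_diff_left)
  also have "\<dots> \<le> sqrt CARD('n) * r + norm \<Sigma> * norm D"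
    using inner_matrix_inv_le(1)[OF X D] Cauchy_Schwarz_ineq2[of \<Sigma> D] unfolding r_def by linarith
  also have "\<dots> \<le> sqrt CARD('n) * r + norm \<Sigma> * (r / sqrt \<sigma>)"
    using nD by (intro add_left_mono mult_left_mono) auto
  finally have "r * r \<le> (norm \<Sigma> / sqrt \<sigma> + sqrt CARD('n)) * r"
    by (simp add: power2_eq_square algebra_simps)
  moreover have "0 \<le> norm \<Sigma> / sqrt \<sigma> + sqrt CARD('n)" using \<sigma> by simp
  ultimately show ?thesis using r(1) unfolding r_def[symmetric]
    by (cases "r = 0") (auto simp: mult_le_cancel_right)
qed

lemma step_ok_small:
  assumes X: "pos_def_mat X" and D: "transpose D = D"
    and dec: "f_grad \<Sigma> X \<bullet> D = - hess_form X D D"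
    and a: "0 < a" "a \<le> 1/4" "a * sqrt (hess_form X D D) \<le> 1/2" and \<omega>: "\<omega> \<le> 1/2"
  shows "step_ok \<Sigma> \<omega> X D a"
proof -
  have q: "0 \<le> hess_form X D D" by (rule inner_matrix_inv_le[OF X D])
  have "2 * a + \<omega> \<le> 1" using a \<omega> by simp
  then have "a * hess_form X D D * (2 * a + \<omega>) \<le> a * hess_form X D D * 1"
    using a q by (intro mult_left_mono) auto
  then have "a * (f_grad \<Sigma> X \<bullet> D) + 2 * a\<^sup>2 * hess_form X D D \<le> a * \<omega> * (f_grad \<Sigma> X \<bullet> D)"
    by (simp add: dec power2_eq_square algebra_simps)
  then show ?thesis
    using f_obj_descent(1)[OF X D _ a(3)] f_obj_descent(2)[OF X D _ a(3), where \<Sigma> = \<Sigma>] a(1) by (simp add: step_ok_def)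
qed

section \<open>Global optima\<close>

text \<open>
  The last conjunct covers the degenerate case without any feasible positive definite matrix, in
  which every objective value is infinite.
\<close>
lemma is_global_opt_iff:
  "is_global_opt \<Sigma> S X \<longleftrightarrow> pos_def_mat X \<and>
     (X \<in> feasible_set S \<longrightarrow> (\<forall>Y. pos_def_mat Y \<and> Y \<in> feasible_set S \<longrightarrow> f_obj \<Sigma> X \<le> f_obj \<Sigma> Y)) \<and>
     (X \<notin> feasible_set S \<longrightarrow> (\<forall>Y. pos_def_mat Y \<longrightarrow> Y \<notin> feasible_set S))"
  unfolding is_global_opt_def is_arg_min_def p_ind_def by (auto simp: not_less)

text \<open>
  At the midpoint \<open>Z\<close> of two different optima the two strict tangent inequalities add up to
  \<open>2 f(Z) < f(X) + f(Y)\<close>, because the linear terms cancel.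
\<close>
lemma global_opt_unique:
  fixes X Y \<Sigma> :: "real^'n^'n"
  assumes X: "is_global_opt \<Sigma> S X" "X \<in> feasible_set S" and Y: "is_global_opt \<Sigma> S Y"
  shows "Y = X"
proof (rule ccontr)
  assume ne: "Y \<noteq> X"
  have pd: "pos_def_mat X" "pos_def_mat Y" using X(1) Y by (auto simp: is_global_opt_iff)
  have YF: "Y \<in> feasible_set S" using Y X(2) pd by (auto simp: is_global_opt_iff)
  define Z where "Z = (1/2) *\<^sub>R (X + Y)"
  have "pos_def_mat Z" unfolding pos_def_mat_def
  proof safe
    show "transpose Z = Z" by (simp add: Z_def transpose_scalar transpose_add pos_def_sym pd)
    fix v :: "real^'n" assume "v \<noteq> 0"
    then have "0 < v \<bullet> (X *v v)" "0 < v \<bullet> (Y *v v)" using pd by (auto simp: pos_def_mat_def)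
    then show "0 < v \<bullet> (Z *v v)"
      by (simp add: Z_def scaleR_matrix_vector_assoc[symmetric] matrix_vector_mult_add_rdistrib inner_add_right)
  qed
  have ZF: "Z \<in> feasible_set S" unfolding Z_def using X(2) YF by (intro feasible_scale feasible_add)
  have "Z \<noteq> X" "Z \<noteq> Y"
  proof -
    have "Z - X = (1/2) *\<^sub>R (Y - X)" "Z - Y = (1/2) *\<^sub>R (X - Y)"
      by (simp_all add: Z_def vec_eq_iff field_simps)
    then show "Z \<noteq> X" "Z \<noteq> Y" using ne by auto
  qed
  then have "f_obj \<Sigma> Z + f_grad \<Sigma> Z \<bullet> (X - Z) < f_obj \<Sigma> X"
    "f_obj \<Sigma> Z + f_grad \<Sigma> Z \<bullet> (Y - Z) < f_obj \<Sigma> Y"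
    using f_obj_tangent(2)[OF \<open>pos_def_mat Z\<close>] pd by auto
  moreover have "f_grad \<Sigma> Z \<bullet> (X - Z) + f_grad \<Sigma> Z \<bullet> (Y - Z) = 0"
  proof -
    have "(X - Z) + (Y - Z) = 0" by (simp add: Z_def vec_eq_iff field_simps)
    then show ?thesis by (metis inner_add_right inner_zero_right)
  qed
  moreover have "f_obj \<Sigma> X \<le> f_obj \<Sigma> Z" "f_obj \<Sigma> Y \<le> f_obj \<Sigma> Z"
    using X Y YF ZF \<open>pos_def_mat Z\<close> by (auto simp: is_global_opt_iff)
  ultimately show False by linarith
qed

section \<open>Runs of the algorithm\<close>

locale nloa_run =
  fixes \<Sigma> :: "real^'n^'n" and S :: "('n \<times> 'n) set"
    and \<beta> \<omega> \<sigma> L :: real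
    and X D :: "nat \<Rightarrow> real^'n^'n" and \<alpha> :: "nat \<Rightarrow> real"
  assumes sym_Sigma: "transpose \<Sigma> = \<Sigma>" and sym_S: "sym S"
    and beta: "0 < \<beta>" "\<beta> < 1" and omega: "0 < \<omega>" "\<omega> < 1/2"
    and run: "nloa_sequence \<Sigma> S \<beta> \<omega> X D \<alpha>"
    and sigma: "0 < \<sigma>" and ev: "\<And>t. eigenvalues (f_hess (X t)) \<subseteq> {\<sigma>..L}"
begin

text \<open>
  A threshold for the step size that serves all iterates. Below \<open>1/4\<close> the quadratic term of the
  descent inequality uses up at most half of the linear decrease, which leaves the fraction \<open>\<omega> < 1/2\<close>;
  below the second bound \<open>f_obj_descent\<close> applies, by \<open>newton_decrement_bound\<close>.
\<close>
definition safe_step :: real where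
  "safe_step = min (1/4) (1 / (2 * (norm \<Sigma> / sqrt \<sigma> + sqrt CARD('n))))"

lemma safe_step_pos: "0 < safe_step"
proof -
  have "0 < norm \<Sigma> / sqrt \<sigma> + sqrt CARD('n)"
    using sigma by (intro add_nonneg_pos) auto
  then show ?thesis by (simp add: safe_step_def)
qed

lemma newton: "is_newton_direction \<Sigma> S (X t) (D t)"
  and alpha: "\<alpha> t = \<beta> ^ (LEAST m. step_ok \<Sigma> \<omega> (X t) (D t) (\<beta> ^ m))"
  and step: "X (Suc t) = X t + \<alpha> t *\<^sub>R D t"
  and start: "pos_def_mat (X 0)" "X 0 \<in> feasible_set S"
  using run by (auto simp: nloa_sequence_def)

lemma newton_facts:
  assumes pd: "pos_def_mat (X t)" and feas: "X t \<in> feasible_set S"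
  shows "transpose (D t) = D t" "D t \<in> feasible_set S"
    and "E \<in> feasible_set S \<Longrightarrow> E \<bullet> f_grad \<Sigma> (X t) = - hess_form (X t) E (D t)"
    and "f_grad \<Sigma> (X t) \<bullet> D t = - hess_form (X t) (D t) (D t)"
proof -
  show "transpose (D t) = D t"
    by (rule newton_direction_symmetric[OF pd feas newton sym_Sigma sym_S ev sigma])
  note stat = newton_direction_stationary[OF pd feas newton]
  show "D t \<in> feasible_set S" by (rule stat(1))
  then show "f_grad \<Sigma> (X t) \<bullet> D t = - hess_form (X t) (D t) (D t)"
    using stat(2)[of "D t"] by (simp add: inner_commute)
  show "E \<in> feasible_set S \<Longrightarrow> E \<bullet> f_grad \<Sigma> (X t) = - hess_form (X t) E (D t)"
    by (rule stat(2))
qed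

lemma step_ok_safe:
  assumes pd: "pos_def_mat (X t)" and feas: "X t \<in> feasible_set S"
    and a: "0 < a" "a \<le> safe_step"
  shows "step_ok \<Sigma> \<omega> (X t) (D t) a"
proof (rule step_ok_small[OF pd])
  note nf = newton_facts[OF pd feas]
  show "transpose (D t) = D t" by (rule nf)
  show "f_grad \<Sigma> (X t) \<bullet> D t = - hess_form (X t) (D t) (D t)" by (rule nf)
  show "0 < a" "a \<le> 1/4" "\<omega> \<le> 1/2" using a omega by (auto simp: safe_step_def)
  define c where "c = norm \<Sigma> / sqrt \<sigma> + sqrt CARD('n)"
  have c: "0 < c" unfolding c_def using sigma by (intro add_nonneg_pos) auto
  have "sqrt (hess_form (X t) (D t) (D t)) \<le> c"
    unfolding c_def using hess_form_bounds(1)[OF pd ev, of "D t"] sigma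
    by (intro newton_decrement_bound[OF pd nf(1) nf(4) sigma]) simp
  moreover have "a \<le> 1 / (2 * c)" using a by (simp add: safe_step_def c_def)
  ultimately have "a * sqrt (hess_form (X t) (D t) (D t)) \<le> 1 / (2 * c) * c"
    using a c inner_matrix_inv_le(2)[OF pd nf(1)] by (intro mult_mono) auto
  then show "a * sqrt (hess_form (X t) (D t) (D t)) \<le> 1/2" using c by simp
qed

text \<open>
  Backtracking stops no later than at the first power of \<open>\<beta>\<close> below \<open>safe_step\<close>, so it terminates.
  If it stops after some reductions, the step before the last one was rejected and hence exceeds
  \<open>safe_step\<close>.
\<close>
lemma line_search:
  assumes pd: "pos_def_mat (X t)" and feas: "X t \<in> feasible_set S"
  shows "step_ok \<Sigma> \<omega> (X t) (D t) (\<alpha> t)" "\<beta> * safe_step \<le> \<alpha> t"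
proof -
  define ok where "ok m \<longleftrightarrow> step_ok \<Sigma> \<omega> (X t) (D t) (\<beta> ^ m)" for m
  have okI: "ok m" if "\<beta> ^ m \<le> safe_step" for m
    unfolding ok_def using that beta by (intro step_ok_safe[OF pd feas]) auto
  obtain m where "\<beta> ^ m < safe_step"
    using real_arch_pow_inv[OF safe_step_pos beta(2)] by blast
  then have "ok m" by (intro okI) simp
  then have "ok (Least ok)" by (rule LeastI)
  moreover have alpha': "\<alpha> t = \<beta> ^ Least ok" unfolding alpha ok_def ..
  ultimately show "step_ok \<Sigma> \<omega> (X t) (D t) (\<alpha> t)" by (simp add: ok_def)
  show "\<beta> * safe_step \<le> \<alpha> t"
  proof (cases "Least ok")
    case 0
    have "\<beta> * safe_step \<le> 1 * 1"
      using beta safe_step_pos by (intro mult_mono) (auto simp: safe_step_def)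
    then show ?thesis by (simp add: alpha' 0)
  next
    case (Suc k)
    then have "\<not> ok k" using not_less_Least[of k ok] by simp
    then have "safe_step \<le> \<beta> ^ k" using okI[of k] by linarith
    then show ?thesis using beta by (simp add: alpha' Suc)
  qed
qed

lemma iterates: "pos_def_mat (X t) \<and> X t \<in> feasible_set S"
proof (induction t)
  case 0
  show ?case using start by simp
next
  case (Suc t)
  then have "step_ok \<Sigma> \<omega> (X t) (D t) (\<alpha> t)" "D t \<in> feasible_set S"
    using line_search(1) newton_facts(2) by auto
  with Suc show ?case by (simp add: step step_ok_def feasible_add feasible_scale)
qed

lemmas pd = iterates[THEN conjunct1] and feas = iterates[THEN conjunct2]

definition sq_decrement :: "nat \<Rightarrow> real" where
  "sq_decrement t = hess_form (X t) (D t) (D t)"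

lemma sq_decrement_nonneg: "0 \<le> sq_decrement t"
  unfolding sq_decrement_def by (rule inner_matrix_inv_le(2)[OF pd newton_facts(1)[OF pd feas]])

lemma f_obj_decrease: "f_obj \<Sigma> (X (Suc t)) \<le> f_obj \<Sigma> (X t) - \<beta> * safe_step * \<omega> * sq_decrement t"
proof -
  have "f_obj \<Sigma> (X (Suc t)) \<le> f_obj \<Sigma> (X t) - \<alpha> t * (\<omega> * sq_decrement t)"
    using line_search(1)[OF pd feas, of t]
    by (simp add: step step_ok_def newton_facts(4)[OF pd feas] sq_decrement_def mult.assoc)
  moreover have "\<beta> * safe_step * (\<omega> * sq_decrement t) \<le> \<alpha> t * (\<omega> * sq_decrement t)"
    using line_search(2)[OF pd feas, of t] omega sq_decrement_nonneg[of t] by (intro mult_right_mono) auto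
  ultimately show ?thesis by (simp add: mult.assoc)
qed

lemma f_obj_decseq: "decseq (\<lambda>t. f_obj \<Sigma> (X t))"
proof (rule decseq_SucI)
  fix t
  have "0 \<le> \<beta> * safe_step * \<omega> * sq_decrement t"
    using beta omega safe_step_pos sq_decrement_nonneg[of t] by simp
  then show "f_obj \<Sigma> (X (Suc t)) \<le> f_obj \<Sigma> (X t)" using f_obj_decrease[of t] by linarith
qed

text \<open>
  Evaluate the lower eigenvalue bound on the Hessian at the iterate itself: \<open>\<langle>X, W X W\<rangle> = \<langle>X, W\<rangle> = n\<close>.
\<close>
lemma iterates_bounded: "norm (X t) \<le> sqrt (CARD('n) / \<sigma>)"
proof -
  have "\<sigma> * (norm (X t))\<^sup>2 \<le> CARD('n)"
    using hess_form_bounds(1)[OF pd ev, of "X t" t] sigma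
    by (simp add: hess_form_self[OF pd] matrix_inv_inner_self[OF pd])
  then show ?thesis using sigma by (intro real_le_rsqrt) (simp add: field_simps)
qed

text \<open>
  Convexity bounds \<open>f\<close> below by an affine function, and the iterates are bounded.
\<close>
lemma f_obj_bounded_below: "\<exists>m. \<forall>t. m \<le> f_obj \<Sigma> (X t)"
proof (intro exI allI)
  fix t
  let ?G = "f_grad \<Sigma> (X 0)"
  have "- (norm ?G * norm (X t - X 0)) \<le> ?G \<bullet> (X t - X 0)"
    using Cauchy_Schwarz_ineq2[of ?G "X t - X 0"] by linarith
  moreover have "norm (X t - X 0) \<le> 2 * sqrt (CARD('n) / \<sigma>)"
    using norm_triangle_ineq4[of "X t" "X 0"] iterates_bounded[of t] iterates_bounded[of 0] by linarith
  then have "norm ?G * norm (X t - X 0) \<le> norm ?G * (2 * sqrt (CARD('n) / \<sigma>))"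
    by (intro mult_left_mono) auto
  ultimately show "f_obj \<Sigma> (X 0) - norm ?G * (2 * sqrt (CARD('n) / \<sigma>)) \<le> f_obj \<Sigma> (X t)"
    using f_obj_tangent(1)[OF pd[of 0] pd[of t], of \<Sigma>] by linarith
qed

lemma sq_decrement_tendsto_0: "sq_decrement \<longlonglongrightarrow> 0"
proof -
  let ?f = "\<lambda>t. f_obj \<Sigma> (X t)"
  define c where "c = \<beta> * safe_step * \<omega>"
  have c: "0 < c" using beta omega safe_step_pos by (simp add: c_def)
  obtain m where "\<forall>t. m \<le> ?f t" using f_obj_bounded_below by blast
  then obtain l where l: "?f \<longlonglongrightarrow> l"
    using decseq_convergent[OF f_obj_decseq] by metis
  have "(\<lambda>t. (?f t - ?f (Suc t)) / c) \<longlonglongrightarrow> (l - l) / c"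
    using c by (intro tendsto_intros l LIMSEQ_Suc) auto
  then have lim: "(\<lambda>t. (?f t - ?f (Suc t)) / c) \<longlonglongrightarrow> 0" by simp
  show ?thesis
  proof (rule tendsto_sandwich[OF _ _ tendsto_const lim])
    show "\<forall>\<^sub>F t in sequentially. 0 \<le> sq_decrement t" by (simp add: sq_decrement_nonneg)
    have "sq_decrement t \<le> (?f t - ?f (Suc t)) / c" for t
      using f_obj_decrease[of t] c by (simp add: c_def field_simps)
    then show "\<forall>\<^sub>F t in sequentially. sq_decrement t \<le> (?f t - ?f (Suc t)) / c" by simp
  qed
qed

lemma D_tendsto_0: "(\<lambda>t. norm (D t)) \<longlonglongrightarrow> 0"
proof -
  have "(\<lambda>t. sqrt (sq_decrement t / \<sigma>)) \<longlonglongrightarrow> sqrt (0 / \<sigma>)"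
    using sigma by (intro tendsto_intros sq_decrement_tendsto_0) auto
  then have lim: "(\<lambda>t. sqrt (sq_decrement t / \<sigma>)) \<longlonglongrightarrow> 0" by simp
  show ?thesis
  proof (rule tendsto_sandwich[OF _ _ tendsto_const lim])
    have "norm (D t) \<le> sqrt (sq_decrement t / \<sigma>)" for t
      using hess_form_bounds(1)[OF pd ev, of "D t" t] sigma
      by (intro real_le_rsqrt) (simp add: sq_decrement_def field_simps)
    then show "\<forall>\<^sub>F t in sequentially. norm (D t) \<le> sqrt (sq_decrement t / \<sigma>)" by simp
  qed simp
qed

text \<open>
  Testing stationarity with \<open>E = X t\<close> gives \<open>\<langle>\<Sigma>, X t\<rangle> - n = - \<langle>W, D t\<rangle>\<close>, and the right-hand side tends
  to \<open>0\<close>. So \<open>\<langle>\<Sigma>, X t\<rangle>\<close> is positive for some \<open>t\<close>, which excludes that \<open>\<Sigma>\<close> is negative semidefinite.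
\<close>
lemma C1_pos: "0 < C1 \<Sigma> \<sigma>"
proof -
  have "(\<lambda>t. sqrt CARD('n) * sqrt (sq_decrement t)) \<longlonglongrightarrow> sqrt CARD('n) * sqrt 0"
    by (intro tendsto_intros sq_decrement_tendsto_0)
  then have "\<forall>\<^sub>F t in sequentially. sqrt CARD('n) * sqrt (sq_decrement t) < CARD('n)"
    by (rule order_tendstoD(2)) simp
  then obtain t where t: "sqrt CARD('n) * sqrt (sq_decrement t) < CARD('n)"
    using eventually_happens by (metis sequentially_bot)
  have "\<bar>matrix_inv (X t) \<bullet> D t\<bar> < CARD('n)"
    using inner_matrix_inv_le(1)[OF pd[of t] newton_facts(1)[OF pd[of t] feas[of t]]] t
    unfolding sq_decrement_def by linarith
  moreover have "X t \<bullet> f_grad \<Sigma> (X t) = - (matrix_inv (X t) \<bullet> D t)"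
    using newton_facts(3)[OF pd feas feas, of t] by (simp add: hess_form_self[OF pd])
  moreover have "X t \<bullet> f_grad \<Sigma> (X t) = \<Sigma> \<bullet> X t - CARD('n)"
    using matrix_inv_inner_self[OF pd, of t] by (simp add: f_grad_def inner_diff_right inner_commute)
  ultimately have "0 < \<Sigma> \<bullet> X t" by linarith
  then have "0 < max_eigenvalue \<Sigma>" by (rule max_eigenvalue_pos[OF sym_Sigma pd])
  then show ?thesis using sigma by (simp add: C1_def add_pos_pos)
qed

lemma L_ge_sigma: "\<sigma> \<le> L"
  using eigenvalues_symmetric(2)[OF transpose_f_hess[OF pd[of 0]]] ev[of 0] by fastforce

lemma constant_step:
  "\<forall>\<^sub>F \<epsilon> in at_right 0. \<exists>a>0.
     a \<le> min 1 (min (1 / (sqrt L * C1 \<Sigma> \<sigma>) - \<epsilon>) (C2 \<sigma> L \<omega>)) \<and>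
     (\<forall>t. step_ok \<Sigma> \<omega> (X t) (D t) a)"
proof -
  define b where "b = 1 / (sqrt L * C1 \<Sigma> \<sigma>)"
  have L: "0 < L" using sigma L_ge_sigma by linarith
  then have b: "0 < b" using C1_pos by (simp add: b_def)
  have C2: "0 < C2 \<sigma> L \<omega>" using sigma L omega by (simp add: C2_def)
  have "\<forall>\<^sub>F \<epsilon> in at_right 0. \<epsilon> < b"
    using b by (auto simp: eventually_at_right_field)
  then show ?thesis
  proof eventually_elim
    case (elim \<epsilon>)
    define a where "a = min safe_step (min 1 (min (b - \<epsilon>) (C2 \<sigma> L \<omega>)))"
    have "0 < a" using elim C2 safe_step_pos by (simp add: a_def)
    moreover have "step_ok \<Sigma> \<omega> (X t) (D t) a" for t
      by (rule step_ok_safe[OF pd feas \<open>0 < a\<close>]) (simp add: a_def)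
    ultimately show ?case unfolding b_def[symmetric] by (intro exI[of _ a]) (simp add: a_def min_le_iff_disj)
  qed
qed

text \<open>
  The closed conditions pass to the limit. Positive definiteness does so because the decrease of \<open>f\<close>
  keeps \<open>ln det (X t)\<close> bounded below. Optimality is the limit of the tangent inequality at \<open>X t\<close>, whose
  linear term is, by stationarity, an inner product with \<open>D t\<close> in the Hessian metric and vanishes in
  the limit.
\<close>
lemma cluster_point_optimal:
  assumes "cluster_point X X'"
  shows "is_global_opt \<Sigma> S X'" "X' \<in> feasible_set S"
proof -
  obtain r where r: "strict_mono r" and lim: "(\<lambda>k. X (r k)) \<longlonglongrightarrow> X'"
    using assms by (auto simp: cluster_point_def o_def)
  have entry: "(\<lambda>k. X (r k) $ i $ j) \<longlonglongrightarrow> X' $ i $ j" for i j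
    by (intro tendsto_intros lim)
  show F: "X' \<in> feasible_set S"
    unfolding in_feasible_set_iff
  proof (intro allI impI)
    fix i j assume "(i, j) \<notin> S"
    then have "(\<lambda>k. X (r k) $ i $ j) = (\<lambda>k. 0)" using feas by (auto simp: in_feasible_set_iff)
    with entry[of i j] show "X' $ i $ j = 0" by (simp add: LIMSEQ_const_iff)
  qed
  have X'sym: "transpose X' = X'"
  proof -
    have "X (r k) $ j $ i = X (r k) $ i $ j" for k i j
      using arg_cong[OF pos_def_sym[OF pd[of "r k"]], of "\<lambda>M. M $ i $ j"] by (simp add: transpose_def)
    then have "X' $ j $ i = X' $ i $ j" for i j
      using LIMSEQ_unique[OF entry[of i j]] entry[of j i] by simp
    then show ?thesis by (simp add: transpose_def vec_eq_iff)
  qed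
  have psd: "0 \<le> v \<bullet> (X' *v v)" for v
  proof (rule LIMSEQ_le_const)
    show "(\<lambda>k. v \<bullet> (X (r k) *v v)) \<longlonglongrightarrow> v \<bullet> (X' *v v)"
      unfolding inner_vec_def matrix_vector_mult_def by (auto intro!: tendsto_intros entry)
    have "0 \<le> v \<bullet> (X (r k) *v v)" for k
      using pd[of "r k"] unfolding pos_def_mat_def by (cases "v = 0") (auto intro: less_imp_le)
    then show "\<exists>N. \<forall>k\<ge>N. 0 \<le> v \<bullet> (X (r k) *v v)" by blast
  qed
  define c where "c = - (norm \<Sigma> * sqrt (CARD('n) / \<sigma>)) - f_obj \<Sigma> (X 0)"
  \<comment> \<open>\<open>ln det (X t) = \<langle>\<Sigma>, X t\<rangle> - f (X t)\<close>, where the first term is bounded and \<open>f (X t) \<le> f (X 0)\<close>.\<close>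
  have det_ge: "exp c \<le> det (X t)" for t
  proof -
    have "f_obj \<Sigma> (X t) \<le> f_obj \<Sigma> (X 0)" using f_obj_decseq by (simp add: decseq_def)
    moreover have "- (norm \<Sigma> * norm (X t)) \<le> \<Sigma> \<bullet> X t"
      using Cauchy_Schwarz_ineq2[of \<Sigma> "X t"] by linarith
    moreover have "norm \<Sigma> * norm (X t) \<le> norm \<Sigma> * sqrt (CARD('n) / \<sigma>)"
      by (intro mult_left_mono iterates_bounded) simp
    ultimately have "c \<le> ln (det (X t))" by (simp add: c_def f_obj_def)
    then show ?thesis using pos_def_det_pos[OF pd] by (simp add: ln_ge_iff)
  qed
  have det_lim: "(\<lambda>k. det (X (r k))) \<longlonglongrightarrow> det X'" by (rule tendsto_det[OF lim])
  have "exp c \<le> det X'" using det_ge by (intro LIMSEQ_le_const[OF det_lim]) auto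
  then have det: "det X' \<noteq> 0" using exp_gt_zero[of c] by linarith
  have PD: "pos_def_mat X'" by (rule pos_def_of_psd[OF X'sym psd det])
  have f_lim: "(\<lambda>k. f_obj \<Sigma> (X (r k))) \<longlonglongrightarrow> f_obj \<Sigma> X'"
    unfolding f_obj_def using det by (intro tendsto_intros lim det_lim) auto
  have "f_obj \<Sigma> X' \<le> f_obj \<Sigma> Y" if Y: "pos_def_mat Y" "Y \<in> feasible_set S" for Y
  proof -
    have "f_obj \<Sigma> (X t) - L * norm (Y - X t) * norm (D t) \<le> f_obj \<Sigma> Y" for t
    proof -
      have "(Y - X t) \<bullet> f_grad \<Sigma> (X t) = - hess_form (X t) (Y - X t) (D t)"
        by (rule newton_facts(3)[OF pd feas feasible_diff[OF Y(2) feas]])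
      moreover have "\<bar>hess_form (X t) (Y - X t) (D t)\<bar> \<le> L * norm (Y - X t) * norm (D t)"
        using sigma by (intro hess_form_bounds(2)[OF pd ev]) simp
      ultimately show ?thesis
        using f_obj_tangent(1)[OF pd[of t] Y(1), of \<Sigma>] by (simp add: inner_commute)
    qed
    moreover have "(\<lambda>k. f_obj \<Sigma> (X (r k)) - L * norm (Y - X (r k)) * norm (D (r k)))
        \<longlonglongrightarrow> f_obj \<Sigma> X' - L * norm (Y - X') * 0"
      using LIMSEQ_subseq_LIMSEQ[OF D_tendsto_0 r]
      by (intro tendsto_intros f_lim lim) (simp add: o_def)
    ultimately have "f_obj \<Sigma> X' - L * norm (Y - X') * 0 \<le> f_obj \<Sigma> Y"
      by (intro LIMSEQ_le_const2) auto
    then show ?thesis by simp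
  qed
  with PD F show "is_global_opt \<Sigma> S X'" by (simp add: is_global_opt_iff)
qed

end

theorem theorem1:
  fixes \<Sigma> :: "real^'n^'n" and S :: "('n \<times> 'n) set"
    and \<beta> \<omega> \<sigma> L :: real
    and X D :: "nat \<Rightarrow> real^'n^'n" and \<alpha> :: "nat \<Rightarrow> real"
  assumes "transpose \<Sigma> = \<Sigma>" and "sym S"
    and "0 < \<beta>" and "\<beta> < 1" and "0 < \<omega>" and "\<omega> < 1/2"
    and "nloa_sequence \<Sigma> S \<beta> \<omega> X D \<alpha>"
    and "0 < \<sigma>" and "\<And>t. eigenvalues (f_hess (X t)) \<subseteq> {\<sigma>..L}"
  shows "(\<forall>\<^sub>F \<epsilon> in at_right 0. \<exists>a>0.
            a \<le> min 1 (min (1 / (sqrt L * C1 \<Sigma> \<sigma>) - \<epsilon>) (C2 \<sigma> L \<omega>)) \<and>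
            (\<forall>t. step_ok \<Sigma> \<omega> (X t) (D t) a)) \<and>
         decseq (\<lambda>t. f_obj \<Sigma> (X t)) \<and>
         (\<forall>X'. cluster_point X X' \<longrightarrow>
            is_global_opt \<Sigma> S X' \<and> (\<forall>Y. is_global_opt \<Sigma> S Y \<longrightarrow> Y = X'))"
proof -
  interpret nloa_run \<Sigma> S \<beta> \<omega> \<sigma> L X D \<alpha>
    using assms by unfold_locales auto
  show ?thesis
    using constant_step f_obj_decseq cluster_point_optimal global_opt_unique by blast
qed

end
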